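(* Let $P$ be a finitely generated non-symmetric operad over a field of characteristic zero with a finite Gröbner basis of relations. Suppose that the growth of the dimensions $\dim P(n)$ is subexponential. Then the ordinary generating series $G_P(z)=\sum_{n\ge1}\dim P(n)z^n$ is rational. In particular, the sequence of dimensions has polynomial growth with integer exponent: either $\dim P(n)=0$ for all large $n$, or there is an integer $d\ge 0$ such that $0<\limsup_{n\to\infty}\dim P(n)/n^d<\infty$.
   Context: A sequence $\{a_n\}_{n\ge0}$ of nonnegative real numbers has subexponential growth if for each $d>1$ there exists $C>0$ such that $a_n<Cd^n$ for all $n>0$. A non-symmetric (linear) operad $P$ is a collection of vector spaces $P(n)$, $n\ge1$, with an identity in $P(1)$ and partial compositions $\circ_i:P(n)\otimes P(m)\to P(n+m-1)$ satisfying the usual axioms. For a set $\Upsilon=\bigsqcup_{n\ge1}\Upsilon_n$ of generators ($\Upsilon_n$ the $n$-ary ones), the free non-symmetric operad $F(\Upsilon)$ has as basis the tree monomials: planar rooted trees in which each vertex has at least one input and each vertex with $n$ inputs is labeled by an element of $\Upsilon_n$ (the trivial tree is the identity); composition is grafting. $v$ is divisible by $w$ if $v$ contains a connected planar labeled subtree isomorphic to $w$ (its root need not be the root of $v$). An admissible order is a total well-order on tree monomials of each arity compatible with compositions. For $P=F(\Upsilon)/C$, a Gröbner basis of the ideal $C$ is a subset $G\subset C$ such that the leading (largest) monomial of every nonzero element of $C$ is divisible by the leading monomial of some element of $G$. "Finite Gröbner basis" means that $\Upsilon$ and $G$ are finite for some admissible order. *)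

theory Defs
  imports
    "HOL-Library.Poly_Mapping"
    "HOL-Computational_Algebra.Polynomial_FPS"
    "HOL-Analysis.Analysis"
begin

text \<open>
  All components \<open>P(n)\<close> are subspaces of one ambient vector space, which is no restriction since
  any family of vector spaces embeds in its direct sum. They may overlap there, so the partial
  composition \<open>pcomp P n m i : P(n) \<times> P(m) \<rightarrow> P(n + m - 1)\<close> carries the arities as arguments.
  Only \<open>comps P n\<close> with \<open>n \<ge> 1\<close> has a meaning; inputs are numbered from 1.
\<close>

record ('k, 'p) operad =
  scal :: "'k \<Rightarrow> 'p \<Rightarrow> 'p"
  comps :: "nat \<Rightarrow> 'p set"
  unit :: "'p"
  pcomp :: "nat \<Rightarrow> nat \<Rightarrow> nat \<Rightarrow> 'p \<Rightarrow> 'p \<Rightarrow> 'p"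

locale ns_operad = vector_space "scal P"
  for P :: "('k::field, 'p::ab_group_add) operad" +
  assumes subspace_comps: "1 \<le> n \<Longrightarrow> subspace (comps P n)"
    and unit_closed: "unit P \<in> comps P 1"
    and pcomp_closed:
      "\<lbrakk>1 \<le> i; i \<le> n; 1 \<le> m; x \<in> comps P n; y \<in> comps P m\<rbrakk>
        \<Longrightarrow> pcomp P n m i x y \<in> comps P (n + m - 1)"
    and pcomp_add_left:
      "\<lbrakk>1 \<le> i; i \<le> n; 1 \<le> m; x \<in> comps P n; x' \<in> comps P n; y \<in> comps P m\<rbrakk>
        \<Longrightarrow> pcomp P n m i (x + x') y = pcomp P n m i x y + pcomp P n m i x' y"
    and pcomp_add_right:
      "\<lbrakk>1 \<le> i; i \<le> n; 1 \<le> m; x \<in> comps P n; y \<in> comps P m; y' \<in> comps P m\<rbrakk>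
        \<Longrightarrow> pcomp P n m i x (y + y') = pcomp P n m i x y + pcomp P n m i x y'"
    and pcomp_scal_left:
      "\<lbrakk>1 \<le> i; i \<le> n; 1 \<le> m; x \<in> comps P n; y \<in> comps P m\<rbrakk>
        \<Longrightarrow> pcomp P n m i (scal P c x) y = scal P c (pcomp P n m i x y)"
    and pcomp_scal_right:
      "\<lbrakk>1 \<le> i; i \<le> n; 1 \<le> m; x \<in> comps P n; y \<in> comps P m\<rbrakk>
        \<Longrightarrow> pcomp P n m i x (scal P c y) = scal P c (pcomp P n m i x y)"
    and unit_left:
      "\<lbrakk>1 \<le> m; y \<in> comps P m\<rbrakk> \<Longrightarrow> pcomp P 1 m 1 (unit P) y = y"
    and unit_right:
      "\<lbrakk>1 \<le> i; i \<le> n; x \<in> comps P n\<rbrakk> \<Longrightarrow> pcomp P n 1 i x (unit P) = x"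
    and pcomp_sequential:
      "\<lbrakk>1 \<le> i; i \<le> l; 1 \<le> j; j \<le> m; 1 \<le> n;
        x \<in> comps P l; y \<in> comps P m; z \<in> comps P n\<rbrakk>
        \<Longrightarrow> pcomp P (l + m - 1) n (i - 1 + j) (pcomp P l m i x y) z
          = pcomp P l (m + n - 1) i x (pcomp P m n j y z)"
    and pcomp_parallel:
      "\<lbrakk>1 \<le> i; i < k; k \<le> l; 1 \<le> m; 1 \<le> n;
        x \<in> comps P l; y \<in> comps P m; z \<in> comps P n\<rbrakk>
        \<Longrightarrow> pcomp P (l + m - 1) n (k - 1 + m) (pcomp P l m i x y) z
          = pcomp P (l + n - 1) m i (pcomp P l n k x z) y"

definition operad_hom ::
  "('k::field, 'p::ab_group_add) operad \<Rightarrow> ('k, 'q::ab_group_add) operad \<Rightarrow> (nat \<Rightarrow> 'p \<Rightarrow> 'q) \<Rightarrow> bool"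
  where
  "operad_hom P Q \<phi> \<longleftrightarrow>
     (\<forall>n\<ge>1. \<forall>x\<in>comps P n. \<phi> n x \<in> comps Q n) \<and>
     (\<forall>n\<ge>1. \<forall>x\<in>comps P n. \<forall>y\<in>comps P n. \<phi> n (x + y) = \<phi> n x + \<phi> n y) \<and>
     (\<forall>n\<ge>1. \<forall>c. \<forall>x\<in>comps P n. \<phi> n (scal P c x) = scal Q c (\<phi> n x)) \<and>
     \<phi> 1 (unit P) = unit Q \<and>
     (\<forall>n\<ge>1. \<forall>m\<ge>1. \<forall>i\<in>{1..n}. \<forall>x\<in>comps P n. \<forall>y\<in>comps P m.
        \<phi> (n + m - 1) (pcomp P n m i x y) = pcomp Q n m i (\<phi> n x) (\<phi> m y))"

definition operad_surj_hom ::
  "('k::field, 'p::ab_group_add) operad \<Rightarrow> ('k, 'q::ab_group_add) operad \<Rightarrow> (nat \<Rightarrow> 'p \<Rightarrow> 'q) \<Rightarrow> bool"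
  where
  "operad_surj_hom P Q \<phi> \<longleftrightarrow> operad_hom P Q \<phi> \<and> (\<forall>n\<ge>1. \<phi> n ` comps P n = comps Q n)"

definition operad_ideal ::
  "('k::field, 'p::ab_group_add) operad \<Rightarrow> (nat \<Rightarrow> 'p set) \<Rightarrow> bool"
  where
  "operad_ideal P C \<longleftrightarrow>
     (\<forall>n\<ge>1. C n \<subseteq> comps P n \<and> module.subspace (scal P) (C n)) \<and>
     (\<forall>n\<ge>1. \<forall>m\<ge>1. \<forall>i\<in>{1..n}. \<forall>x\<in>comps P n. \<forall>y\<in>comps P m.
        x \<in> C n \<or> y \<in> C m \<longrightarrow> pcomp P n m i x y \<in> C (n + m - 1))"

definition operad_kernel ::
  "('k, 'p) operad \<Rightarrow> (nat \<Rightarrow> 'p \<Rightarrow> 'q::zero) \<Rightarrow> nat \<Rightarrow> 'p set"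
  where "operad_kernel P \<phi> n = {x \<in> comps P n. \<phi> n x = 0}"

definition finite_dim_comps :: "('k::field, 'p::ab_group_add) operad \<Rightarrow> bool"
  where "finite_dim_comps P \<longleftrightarrow>
    (\<forall>n\<ge>1. \<exists>B. finite B \<and> comps P n \<subseteq> module.span (scal P) B)"

definition operad_dim :: "('k::field, 'p::ab_group_add) operad \<Rightarrow> nat \<Rightarrow> nat"
  where "operad_dim P n = (if n = 0 then 0 else vector_space.dim (scal P) (comps P n))"

lemma operad_kernel_ideal:
  assumes "ns_operad P" and "ns_operad Q" and "operad_hom P Q \<phi>"
  shows "operad_ideal P (operad_kernel P \<phi>)"
proof -
  interpret P: ns_operad P by fact
  interpret Q: ns_operad Q by fact
  note h = assms(3)[unfolded operad_hom_def]
  have cl: "\<phi> n x \<in> comps Q n" if "1 \<le> n" "x \<in> comps P n" for n x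
    using h that by blast
  have sc: "\<phi> n (scal P c x) = scal Q c (\<phi> n x)" if "1 \<le> n" "x \<in> comps P n" for n c x
    using h that by blast
  have ad: "\<phi> n (x + y) = \<phi> n x + \<phi> n y" if "1 \<le> n" "x \<in> comps P n" "y \<in> comps P n" for n x y
    using h that by blast
  have pc: "\<phi> (n + m - 1) (pcomp P n m i x y) = pcomp Q n m i (\<phi> n x) (\<phi> m y)"
    if "1 \<le> n" "1 \<le> m" "i \<in> {1..n}" "x \<in> comps P n" "y \<in> comps P m" for n m i x y
    using h that by blast
  have z: "0 \<in> comps P n" "\<phi> n 0 = 0" "0 \<in> comps Q n" if "1 \<le> n" for n
  proof -
    show 0: "0 \<in> comps P n" using P.subspace_comps[OF that] P.subspace_0 by blast
    show "0 \<in> comps Q n" using Q.subspace_comps[OF that] Q.subspace_0 by blast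
    show "\<phi> n 0 = 0" using sc[OF that 0, of 0] by simp
  qed
  have l0: "pcomp Q n m i 0 y = 0" if "1 \<le> n" "1 \<le> m" "i \<in> {1..n}" "y \<in> comps Q m" for n m i y
    using Q.pcomp_scal_left[of i n m 0 y 0] that z(3)[of n] by simp
  have r0: "pcomp Q n m i x 0 = 0" if "1 \<le> n" "1 \<le> m" "i \<in> {1..n}" "x \<in> comps Q n" for n m i x
    using Q.pcomp_scal_right[of i n m x 0 0] that z(3)[of m] by simp
  have "P.subspace (operad_kernel P \<phi> n)" if "1 \<le> n" for n
    using z[OF that] ad[OF that] sc[OF that] P.subspace_comps[OF that]
    by (auto simp: P.subspace_def operad_kernel_def)
  moreover have "pcomp P n m i x y \<in> operad_kernel P \<phi> (n + m - 1)"
    if "1 \<le> n" "1 \<le> m" "i \<in> {1..n}" "x \<in> comps P n" "y \<in> comps P m"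
      "x \<in> operad_kernel P \<phi> n \<or> y \<in> operad_kernel P \<phi> m" for n m i x y
    using that P.pcomp_closed[of i n m x y] pc[OF that(1-5)]
      l0[OF that(1-3) cl[of m y]] r0[OF that(1-3) cl[of n x]]
    by (auto simp: operad_kernel_def)
  ultimately show ?thesis
    unfolding operad_ideal_def by (auto simp: operad_kernel_def)
qed

text \<open>The trivial tree is \<open>Leaf\<close>; each \<open>Leaf\<close> below a vertex is an input of the tree.\<close>

datatype 'g ptree = Leaf | Node 'g "'g ptree list"

fun arity :: "'g ptree \<Rightarrow> nat" where
  "arity Leaf = 1"
| "arity (Node g ts) = sum_list (map arity ts)"

fun tree_monomial :: "'g set \<Rightarrow> ('g \<Rightarrow> nat) \<Rightarrow> 'g ptree \<Rightarrow> bool" where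
  "tree_monomial \<Upsilon> ar Leaf \<longleftrightarrow> True"
| "tree_monomial \<Upsilon> ar (Node g ts) \<longleftrightarrow>
     g \<in> \<Upsilon> \<and> length ts = ar g \<and> ts \<noteq> [] \<and> (\<forall>t\<in>set ts. tree_monomial \<Upsilon> ar t)"

definition tree_monomials :: "'g set \<Rightarrow> ('g \<Rightarrow> nat) \<Rightarrow> nat \<Rightarrow> 'g ptree set" where
  "tree_monomials \<Upsilon> ar n = {t. tree_monomial \<Upsilon> ar t \<and> arity t = n}"

text \<open>\<open>graft u i v\<close> replaces the \<open>i\<close>-th leaf of \<open>u\<close>, from the left, by \<open>v\<close>.\<close>

fun graft :: "'g ptree \<Rightarrow> nat \<Rightarrow> 'g ptree \<Rightarrow> 'g ptree"
  and graft_list :: "'g ptree list \<Rightarrow> nat \<Rightarrow> 'g ptree \<Rightarrow> 'g ptree list" where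
  "graft Leaf i v = v"
| "graft (Node g ts) i v = Node g (graft_list ts i v)"
| "graft_list [] i v = []"
| "graft_list (t # ts) i v =
     (if i \<le> arity t then graft t i v # ts else t # graft_list ts (i - arity t) v)"

text \<open>\<open>at_root w t\<close>: some subtree of \<open>t\<close> containing the root of \<open>t\<close> is isomorphic to \<open>w\<close>.\<close>

fun at_root :: "'g ptree \<Rightarrow> 'g ptree \<Rightarrow> bool" where
  "at_root Leaf t \<longleftrightarrow> True"
| "at_root (Node g ws) Leaf \<longleftrightarrow> False"
| "at_root (Node g ws) (Node h ts) \<longleftrightarrow> g = h \<and> list_all2 at_root ws ts"

fun divides :: "'g ptree \<Rightarrow> 'g ptree \<Rightarrow> bool" where
  "divides w Leaf \<longleftrightarrow> at_root w Leaf"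
| "divides w (Node g ts) \<longleftrightarrow> at_root w (Node g ts) \<or> (\<exists>t\<in>set ts. divides w t)"

text \<open>Elements of \<open>F(\<Upsilon>)(n)\<close> are finitely supported functions on the tree monomials of arity \<open>n\<close>.\<close>

definition graft_lin ::
  "nat \<Rightarrow> ('g ptree \<Rightarrow>\<^sub>0 'k::comm_ring_1) \<Rightarrow> ('g ptree \<Rightarrow>\<^sub>0 'k) \<Rightarrow> ('g ptree \<Rightarrow>\<^sub>0 'k)" where
  "graft_lin i f g =
     (\<Sum>u\<in>Poly_Mapping.keys f. \<Sum>v\<in>Poly_Mapping.keys g.
        Poly_Mapping.single (graft u i v) (Poly_Mapping.lookup f u * Poly_Mapping.lookup g v))"

definition free_operad ::
  "'g set \<Rightarrow> ('g \<Rightarrow> nat) \<Rightarrow> ('k::field, 'g ptree \<Rightarrow>\<^sub>0 'k) operad" where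
  "free_operad \<Upsilon> ar =
     \<lparr>scal = (\<lambda>c. Poly_Mapping.map ((*) c)),
      comps = (\<lambda>n. {f. Poly_Mapping.keys f \<subseteq> tree_monomials \<Upsilon> ar n}),
      unit = Poly_Mapping.single Leaf 1,
      pcomp = (\<lambda>n m i. graft_lin i)\<rparr>"

text \<open>
  One relation \<open>r\<close> encodes the orders in all arities; pairs of trees of different arities are
  ignored.
\<close>

definition admissible_order ::
  "'g set \<Rightarrow> ('g \<Rightarrow> nat) \<Rightarrow> 'g ptree rel \<Rightarrow> bool" where
  "admissible_order \<Upsilon> ar r \<longleftrightarrow>
     (\<forall>n\<ge>1. well_order_on (tree_monomials \<Upsilon> ar n) (Restr r (tree_monomials \<Upsilon> ar n))) \<and>
     (\<forall>n\<ge>1. \<forall>m\<ge>1. \<forall>i\<in>{1..n}.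
        \<forall>u\<in>tree_monomials \<Upsilon> ar n. \<forall>u'\<in>tree_monomials \<Upsilon> ar n. \<forall>v\<in>tree_monomials \<Upsilon> ar m.
          (u, u') \<in> r - Id \<longrightarrow> (graft u i v, graft u' i v) \<in> r - Id) \<and>
     (\<forall>n\<ge>1. \<forall>m\<ge>1. \<forall>i\<in>{1..n}.
        \<forall>u\<in>tree_monomials \<Upsilon> ar n. \<forall>v\<in>tree_monomials \<Upsilon> ar m. \<forall>v'\<in>tree_monomials \<Upsilon> ar m.
          (v, v') \<in> r - Id \<longrightarrow> (graft u i v, graft u i v') \<in> r - Id)"

definition leading_monomial :: "'g ptree rel \<Rightarrow> ('g ptree \<Rightarrow>\<^sub>0 'k::zero) \<Rightarrow> 'g ptree" where
  "leading_monomial r f =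
     (THE u. u \<in> Poly_Mapping.keys f \<and> (\<forall>v\<in>Poly_Mapping.keys f. (v, u) \<in> r))"

text \<open>A zero element of \<open>G\<close>, having no leading monomial, does not count.\<close>

definition groebner_basis ::
  "'g ptree rel \<Rightarrow> (nat \<Rightarrow> ('g ptree \<Rightarrow>\<^sub>0 'k::zero) set) \<Rightarrow> ('g ptree \<Rightarrow>\<^sub>0 'k) set \<Rightarrow> bool" where
  "groebner_basis r C G \<longleftrightarrow>
     G \<subseteq> (\<Union>n\<in>{1..}. C n) \<and>
     (\<forall>n\<ge>1. \<forall>f\<in>C n. f \<noteq> 0 \<longrightarrow>
        (\<exists>g\<in>G. g \<noteq> 0 \<and> divides (leading_monomial r g) (leading_monomial r f)))"

definition subexponential_growth :: "(nat \<Rightarrow> real) \<Rightarrow> bool" where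
  "subexponential_growth a \<longleftrightarrow> (\<forall>d>1. \<exists>C>0. \<forall>n>0. a n < C * d ^ n)"

definition operad_gen_series :: "('k::field, 'p::ab_group_add) operad \<Rightarrow> rat fps" where
  "operad_gen_series P = Abs_fps (\<lambda>n. of_nat (operad_dim P n))"

definition rational_fps :: "'a::field fps \<Rightarrow> bool" where
  "rational_fps A \<longleftrightarrow>
     (\<exists>p q. poly q 0 \<noteq> 0 \<and> A = fps_of_poly p / fps_of_poly q)"

definition polynomial_growth :: "(nat \<Rightarrow> real) \<Rightarrow> bool" where
  "polynomial_growth a \<longleftrightarrow>
     (\<exists>N. \<forall>n\<ge>N. a n = 0) \<or>
     (\<exists>d::nat. 0 < limsup (\<lambda>n. ereal (a n / real n ^ d)) \<and>
               limsup (\<lambda>n. ereal (a n / real n ^ d)) < \<infinity>)"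

lemma arity_graft:
  "1 \<le> i \<Longrightarrow> i \<le> arity t \<Longrightarrow> arity (graft t i u) + 1 = arity t + arity u"
  "1 \<le> i \<Longrightarrow> i \<le> sum_list (map arity ts) \<Longrightarrow>
     sum_list (map arity (graft_list ts i u)) + 1 = sum_list (map arity ts) + arity u"
  by (induction t i u and ts i u rule: graft_graft_list.induct) auto

lemma length_graft_list [simp]: "length (graft_list ts i u) = length ts"
  by (induction ts arbitrary: i) auto

lemma graft_list_eq_Nil [simp]: "graft_list ts i u = [] \<longleftrightarrow> ts = []"
  by (metis length_graft_list length_0_conv)

lemma tree_monomial_graft:
  "tree_monomial \<Upsilon> ar t \<Longrightarrow> tree_monomial \<Upsilon> ar u \<Longrightarrow> tree_monomial \<Upsilon> ar (graft t i u)"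
  "\<forall>t\<in>set ts. tree_monomial \<Upsilon> ar t \<Longrightarrow> tree_monomial \<Upsilon> ar u \<Longrightarrow>
     \<forall>t\<in>set (graft_list ts i u). tree_monomial \<Upsilon> ar t"
  by (induction t i u and ts i u rule: graft_graft_list.induct) auto

lemma graft_Leaf:
  fixes t :: "'g ptree" and ts :: "'g ptree list"
  shows
  "1 \<le> i \<Longrightarrow> i \<le> arity t \<Longrightarrow> graft t i Leaf = t"
  "1 \<le> i \<Longrightarrow> i \<le> sum_list (map arity ts) \<Longrightarrow> graft_list ts i Leaf = ts"
proof (induction t i "Leaf :: 'g ptree" and ts i "Leaf :: 'g ptree"
    rule: graft_graft_list.induct)
qed auto

lemma graft_sequential:
  "\<lbrakk>1 \<le> i; i \<le> arity t; 1 \<le> j; j \<le> arity u\<rbrakk>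
     \<Longrightarrow> graft (graft t i u) (i - 1 + j) v = graft t i (graft u j v)"
  "\<lbrakk>1 \<le> i; i \<le> sum_list (map arity ts); 1 \<le> j; j \<le> arity u\<rbrakk>
     \<Longrightarrow> graft_list (graft_list ts i u) (i - 1 + j) v = graft_list ts i (graft u j v)"
proof (induction t i u and ts i u rule: graft_graft_list.induct)
  case (4 t ts i u)
  then show ?case
    using arity_graft(1)[of i t u] by (auto simp: algebra_simps)
qed auto

lemma graft_parallel:
  "\<lbrakk>1 \<le> i; i < k; k \<le> arity t\<rbrakk>
     \<Longrightarrow> graft (graft t i u) (k - 1 + arity u) v = graft (graft t k v) i u"
  "\<lbrakk>1 \<le> i; i < k; k \<le> sum_list (map arity ts)\<rbrakk>
     \<Longrightarrow> graft_list (graft_list ts i u) (k - 1 + arity u) v = graft_list (graft_list ts k v) i u"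
proof (induction t i u and ts i u arbitrary: k and k rule: graft_graft_list.induct)
  case (4 t ts i u)
  consider "k \<le> arity t" | "i \<le> arity t" "arity t < k" | "arity t < i" by linarith
  then show ?case
  proof cases
    case 1
    then show ?thesis
      using 4 arity_graft(1)[of i t u] arity_graft(1)[of k t v] by auto
  next
    case 2
    then have "k - 1 + arity u - arity (graft t i u) = k - arity t"
      "\<not> k - 1 + arity u \<le> arity (graft t i u)"
      using 4(3) arity_graft(1)[of i t u] by auto
    then show ?thesis using 2 by simp
  next
    case 3
    have "graft_list (graft_list ts (i - arity t) u) (k - arity t - 1 + arity u) v =
        graft_list (graft_list ts (k - arity t) v) (i - arity t) u"
      using 4(2)[of "k - arity t"] 4(3-5) 3 by simp
    moreover have "\<not> k - 1 + arity u \<le> arity t"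
      using 3 4(3-5) by simp
    moreover have "k - 1 + arity u - arity t = k - arity t - 1 + arity u"
      using 3 4 by simp
    ultimately show ?thesis using 3 4(3-5) by simp
  qed
qed auto

lemma graft_tree_monomials:
  assumes "1 \<le> i" "i \<le> n" "u \<in> tree_monomials \<Upsilon> ar n" "v \<in> tree_monomials \<Upsilon> ar m"
  shows "graft u i v \<in> tree_monomials \<Upsilon> ar (n + m - 1)"
  using assms arity_graft(1)[of i u v] tree_monomial_graft(1)[of \<Upsilon> ar u v i]
  by (auto simp: tree_monomials_def)

lemma graft_lin_superset:
  assumes "finite A" "Poly_Mapping.keys f \<subseteq> A" "finite B" "Poly_Mapping.keys g \<subseteq> B"
  shows "graft_lin i f g = (\<Sum>u\<in>A. \<Sum>v\<in>B.
    Poly_Mapping.single (graft u i v) (Poly_Mapping.lookup f u * Poly_Mapping.lookup g v))"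
proof -
  have "(\<Sum>v\<in>Poly_Mapping.keys g.
          Poly_Mapping.single (graft u i v) (Poly_Mapping.lookup f u * Poly_Mapping.lookup g v)) =
        (\<Sum>v\<in>B.
          Poly_Mapping.single (graft u i v) (Poly_Mapping.lookup f u * Poly_Mapping.lookup g v))"
    for u using assms by (intro sum.mono_neutral_left) (auto simp: in_keys_iff)
  then show ?thesis
    unfolding graft_lin_def using assms
    by (simp, intro sum.mono_neutral_left) (auto simp: in_keys_iff)
qed

lemma graft_lin_add_left: "graft_lin i (f + f') g = graft_lin i f g + graft_lin i f' g"
proof -
  let ?A = "Poly_Mapping.keys f \<union> Poly_Mapping.keys f'"
  have *: "graft_lin i h g = (\<Sum>u\<in>?A. \<Sum>v\<in>Poly_Mapping.keys g.
      Poly_Mapping.single (graft u i v) (Poly_Mapping.lookup h u * Poly_Mapping.lookup g v))"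
    if "Poly_Mapping.keys h \<subseteq> ?A" for h
    using that by (intro graft_lin_superset) auto
  show ?thesis
    by (subst (1 2 3) *) (auto simp: Poly_Mapping.keys_add lookup_add single_add distrib_right sum.distrib)
qed

lemma graft_lin_add_right: "graft_lin i f (g + g') = graft_lin i f g + graft_lin i f g'"
proof -
  let ?A = "Poly_Mapping.keys g \<union> Poly_Mapping.keys g'"
  have *: "graft_lin i f h = (\<Sum>u\<in>Poly_Mapping.keys f. \<Sum>v\<in>?A.
      Poly_Mapping.single (graft u i v) (Poly_Mapping.lookup f u * Poly_Mapping.lookup h v))"
    if "Poly_Mapping.keys h \<subseteq> ?A" for h
    using that by (intro graft_lin_superset) auto
  show ?thesis
    by (subst (1 2 3) *) (auto simp: Poly_Mapping.keys_add lookup_add single_add distrib_left sum.distrib)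
qed

lemma lookup_scale:
  "Poly_Mapping.lookup (Poly_Mapping.map ((*) c) f) u = (c::'k::comm_ring_1) * Poly_Mapping.lookup f u"
  by (simp add: Poly_Mapping.map.rep_eq when_def)

lemma keys_scale:
  "Poly_Mapping.keys (Poly_Mapping.map ((*) (c::'k::comm_ring_1)) f) \<subseteq> Poly_Mapping.keys f"
  by (auto simp: in_keys_iff lookup_scale)

lemma scale_single:
  "Poly_Mapping.map ((*) (c::'k::comm_ring_1)) (Poly_Mapping.single u a) = Poly_Mapping.single u (c * a)"
  by (rule poly_mapping_eqI) (simp add: lookup_scale lookup_single when_def)

lemma scale_sum:
  "Poly_Mapping.map ((*) (c::'k::comm_ring_1)) (sum h A) = (\<Sum>x\<in>A. Poly_Mapping.map ((*) c) (h x))"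
  by (rule poly_mapping_eqI) (simp add: lookup_scale lookup_sum sum_distrib_left)

lemma graft_lin_scale_left:
  "graft_lin i (Poly_Mapping.map ((*) c) f) g = Poly_Mapping.map ((*) c) (graft_lin i f g)"
  by (subst graft_lin_superset[of "Poly_Mapping.keys f" _ "Poly_Mapping.keys g"])
    (simp_all add: keys_scale graft_lin_def scale_sum scale_single lookup_scale mult.assoc)

lemma graft_lin_scale_right:
  "graft_lin i f (Poly_Mapping.map ((*) c) g) = Poly_Mapping.map ((*) c) (graft_lin i f g)"
  by (subst graft_lin_superset[of "Poly_Mapping.keys f" _ "Poly_Mapping.keys g"])
    (simp_all add: keys_scale graft_lin_def scale_sum scale_single lookup_scale
      mult.left_commute)

lemma graft_lin_single:
  "graft_lin i (Poly_Mapping.single u a) (Poly_Mapping.single v b) =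
   Poly_Mapping.single (graft u i v) (a * b)"
  by (subst graft_lin_superset[of "{u}" _ "{v}"]) auto

lemma graft_lin_0 [simp]: "graft_lin i 0 g = 0" "graft_lin i f 0 = 0"
  by (simp_all add: graft_lin_def)

lemma graft_lin_sum_left: "graft_lin i (sum h A) g = (\<Sum>x\<in>A. graft_lin i (h x) g)"
  by (induction A rule: infinite_finite_induct) (auto simp: graft_lin_add_left)

lemma graft_lin_sum_right: "graft_lin i f (sum h A) = (\<Sum>x\<in>A. graft_lin i f (h x))"
  by (induction A rule: infinite_finite_induct) (auto simp: graft_lin_add_right)

lemma free_induct [consumes 1, case_names zero single add]:
  fixes f :: "'a \<Rightarrow>\<^sub>0 'k::comm_monoid_add"
  assumes "Poly_Mapping.keys f \<subseteq> A"
    and "Q 0" and "\<And>u a. u \<in> A \<Longrightarrow> Q (Poly_Mapping.single u a)"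
    and "\<And>f g. Q f \<Longrightarrow> Q g \<Longrightarrow> Q (f + g)"
  shows "Q f"
proof -
  have "Q (\<Sum>u\<in>S. Poly_Mapping.single u (Poly_Mapping.lookup f u))"
    if "finite S" "S \<subseteq> A" for S
    using that by (induction S) (auto intro: assms)
  moreover have "f = (\<Sum>u\<in>Poly_Mapping.keys f. Poly_Mapping.single u (Poly_Mapping.lookup f u))"
    by (rule poly_mapping_eqI) (simp add: lookup_sum lookup_single when_def in_keys_iff)
  ultimately show ?thesis
    using assms(1) by (metis finite_keys)
qed

theorem ns_operad_free_operad: "ns_operad (free_operad \<Upsilon> ar :: ('k::field, 'g ptree \<Rightarrow>\<^sub>0 'k) operad)"
proof -
  let ?P = "free_operad \<Upsilon> ar :: ('k, 'g ptree \<Rightarrow>\<^sub>0 'k) operad"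
  let ?T = "tree_monomials \<Upsilon> ar"
  interpret vector_space "scal ?P"
    by standard (auto intro!: poly_mapping_eqI
        simp: free_operad_def lookup_scale lookup_add algebra_simps)
  have closed: "Poly_Mapping.keys (graft_lin i x y) \<subseteq> ?T (n + m - 1)"
    if "1 \<le> i" "i \<le> n" "Poly_Mapping.keys x \<subseteq> ?T n" "Poly_Mapping.keys y \<subseteq> ?T m"
    for i n m and x y :: "'g ptree \<Rightarrow>\<^sub>0 'k"
  proof -
    have "Poly_Mapping.keys (Poly_Mapping.single (graft u i v) a) \<subseteq> ?T (n + m - 1)"
      if "u \<in> Poly_Mapping.keys x" "v \<in> Poly_Mapping.keys y" for u v and a :: 'k
      using that graft_tree_monomials[OF \<open>1 \<le> i\<close> \<open>i \<le> n\<close>, of u \<Upsilon> ar v m] \<open>_ \<subseteq> ?T n\<close> \<open>_ \<subseteq> ?T m\<close>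
      by auto
    then show ?thesis
      unfolding graft_lin_def
      by (intro order.trans[OF Poly_Mapping.keys_sum] UN_least)
  qed
  have seq: "graft_lin (i - 1 + j) (graft_lin i x y) z = graft_lin i x (graft_lin j y z)"
    if ij: "1 \<le> i" "i \<le> l" "1 \<le> j" "j \<le> m"
      and k: "Poly_Mapping.keys x \<subseteq> ?T l" "Poly_Mapping.keys y \<subseteq> ?T m"
    for i j l m and x y z :: "'g ptree \<Rightarrow>\<^sub>0 'k"
    using k(1)
  proof (induction x rule: free_induct)
    case (single u a)
    show ?case
      using k(2)
    proof (induction y rule: free_induct)
      case (single v b)
      show ?case
        by (induction z rule: free_induct[OF subset_UNIV])
          (use single \<open>u \<in> _\<close> ij graft_sequential(1)[of i u j v] in
            \<open>auto simp: graft_lin_single graft_lin_add_right tree_monomials_def mult.assoc\<close>)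
    qed (simp_all add: graft_lin_add_left graft_lin_add_right)
  qed (simp_all add: graft_lin_add_left)
  have par: "graft_lin (k - 1 + m) (graft_lin i x y) z = graft_lin i (graft_lin k x z) y"
    if ik: "1 \<le> i" "i < k" "k \<le> l"
      and k: "Poly_Mapping.keys x \<subseteq> ?T l" "Poly_Mapping.keys y \<subseteq> ?T m"
    for i k l m and x y z :: "'g ptree \<Rightarrow>\<^sub>0 'k"
    using k(1)
  proof (induction x rule: free_induct)
    case (single u a)
    show ?case
      using k(2)
    proof (induction y rule: free_induct)
      case (single v b)
      show ?case
        by (induction z rule: free_induct[OF subset_UNIV])
          (use single \<open>u \<in> _\<close> ik graft_parallel(1)[of i k u v] in
            \<open>auto simp: graft_lin_single graft_lin_add_left graft_lin_add_right
              tree_monomials_def mult_ac\<close>)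
    qed (simp_all add: graft_lin_add_left graft_lin_add_right)
  qed (simp_all add: graft_lin_add_left)
  have ul: "graft_lin 1 (Poly_Mapping.single Leaf 1) y = y" for y :: "'g ptree \<Rightarrow>\<^sub>0 'k"
    by (induction y rule: free_induct[OF subset_UNIV])
      (simp_all add: graft_lin_single graft_lin_add_right)
  have ur: "graft_lin i x (Poly_Mapping.single Leaf 1) = x"
    if "1 \<le> i" "i \<le> n" "Poly_Mapping.keys x \<subseteq> ?T n" for i n and x :: "'g ptree \<Rightarrow>\<^sub>0 'k"
    using that(3)
    by (induction x rule: free_induct)
      (use that(1,2) in \<open>auto simp: graft_lin_single graft_lin_add_left tree_monomials_def graft_Leaf\<close>)
  have sub: "subspace (comps ?P n)" for n
    unfolding subspace_def
    by (simp add: free_operad_def)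
      (meson subset_trans[OF Poly_Mapping.keys_add] subset_trans[OF keys_scale] Un_least)
  have un: "unit ?P \<in> comps ?P 1"
    by (simp add: free_operad_def tree_monomials_def)
  show ?thesis
  proof (intro ns_operad.intro ns_operad_axioms.intro vector_space_axioms sub un, goal_cases)
    case (1 i n m x y)
    then show ?case using closed[of i n x y m] by (simp add: free_operad_def)
  next
    case (6 m y)
    show ?case using ul by (simp add: free_operad_def)
  next
    case (7 i n x)
    then show ?case using ur[of i n x] by (simp add: free_operad_def)
  next
    case (8 i l j m n x y z)
    then show ?case using seq[of i l j m x y z] by (simp add: free_operad_def)
  next
    case (9 i k l m n x y z)
    then show ?case using par[of i k l x y m z] by (simp add: free_operad_def)
  qed (simp_all add: free_operad_def graft_lin_add_left graft_lin_add_right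
      graft_lin_scale_left graft_lin_scale_right)
qed

end

theory Submission
  imports Defs
begin

text \<open>
  The dimension of \<open>P(n)\<close> is the number of normal tree monomials of arity \<open>n\<close>, and the normal
  monomials are recognised by a finite bottom-up tree automaton. If a state could reproduce itself
  in two different ways, the number of trees would grow exponentially; hence subexponential growth
  forces every strongly connected component of states to be a single cycle with a unique way
  around it. A cycle of total weight \<open>m\<close> gives \<open>A = R + z ^ m * A\<close>, where \<open>R\<close> is a polynomial in
  the series of lower states. Moreover \<open>m > 0\<close>, as otherwise some arity would have infinitely many
  normal monomials. So all the series are polynomials divided by products of factors \<open>1 - z ^ m\<close>.
\<close>

section \<open>Generating series and quasi-polynomials\<close>

text \<open>Two different productions that return to the same state need not have disjoint images:
  if they recurse at different positions, one tree may arise from both. Images are therefore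
  compared only above an arity threshold, and iterates climb past it because every cycle has
  positive weight. The uniqueness obtained in this way concerns more than states: label, recursive
  position and all sibling trees are forced, so each step around a cycle is a single rigid context.
  This is why the coefficient of \<open>A\<close> in the fixpoint equation is a bare power of
  \<open>z\<close> without any sibling series. Contexts are never built as data. An injective map on
  trees that shifts the arity by a constant and increases the size is enough for counting. Size is
  tracked next to arity because unary vertices add no leaves. The denominators are kept explicit
  because rationality alone would not bound the growth. Their zeros are roots of unity, which makes
  the coefficients eventually polynomial along each residue class.\<close>

definition gen_series :: "('x \<Rightarrow> nat) \<Rightarrow> 'x set \<Rightarrow> rat fps" where
  "gen_series w S = Abs_fps (\<lambda>n. of_nat (card {x \<in> S. w x = n}))"

definition graded_finite :: "('x \<Rightarrow> nat) \<Rightarrow> 'x set \<Rightarrow> bool" where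
  "graded_finite w S \<longleftrightarrow> (\<forall>n. finite {x \<in> S. w x = n})"

lemma graded_finite_subset:
  assumes "graded_finite w S" "S' \<subseteq> S" shows "graded_finite w S'"
  unfolding graded_finite_def
proof
  fix n
  have "finite {x \<in> S. w x = n}" using assms(1) by (simp add: graded_finite_def)
  moreover have "{x \<in> S'. w x = n} \<subseteq> {x \<in> S. w x = n}" using assms(2) by auto
  ultimately show "finite {x \<in> S'. w x = n}" by (rule rev_finite_subset)
qed

lemma gen_series_empty [simp]: "gen_series w {} = 0"
  by (simp add: gen_series_def fps_eq_iff)

lemma gen_series_singleton: "gen_series w {x} = fps_X ^ w x"
proof -
  have "{y \<in> {x}. w y = n} = (if w x = n then {x} else {})" for n by auto
  then show ?thesis by (simp add: gen_series_def fps_eq_iff)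
qed

lemma gen_series_Un:
  assumes "graded_finite w S" "graded_finite w S'" "S \<inter> S' = {}"
  shows "gen_series w (S \<union> S') = gen_series w S + gen_series w S'"
proof (rule fps_ext)
  fix n
  have "{x \<in> S \<union> S'. w x = n} = {x \<in> S. w x = n} \<union> {x \<in> S'. w x = n}" by auto
  then have "card {x \<in> S \<union> S'. w x = n} = card {x \<in> S. w x = n} + card {x \<in> S'. w x = n}"
    using assms by (simp add: graded_finite_def) (subst card_Un_disjoint; auto)
  then show "fps_nth (gen_series w (S \<union> S')) n = fps_nth (gen_series w S + gen_series w S') n"
    by (simp add: gen_series_def)
qed

lemma gen_series_UN:
  assumes "finite I" "\<And>i. i \<in> I \<Longrightarrow> graded_finite w (S i)"
    and "\<And>i j. i \<in> I \<Longrightarrow> j \<in> I \<Longrightarrow> i \<noteq> j \<Longrightarrow> S i \<inter> S j = {}"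
  shows "graded_finite w (\<Union>i\<in>I. S i) \<and> gen_series w (\<Union>i\<in>I. S i) = (\<Sum>i\<in>I. gen_series w (S i))"
  using assms
proof (induction I rule: finite_induct)
  case empty
  then show ?case by (simp add: graded_finite_def)
next
  case (insert i I)
  have gf: "graded_finite w (S i)" "graded_finite w (\<Union>j\<in>I. S j)"
    using insert by auto
  moreover have "S i \<inter> (\<Union>j\<in>I. S j) = {}"
    using insert.prems(2)[of i] insert.hyps by fastforce
  moreover have "graded_finite w (S i \<union> (\<Union>j\<in>I. S j))"
    unfolding graded_finite_def
  proof
    fix n
    have "{x \<in> S i \<union> (\<Union>j\<in>I. S j). w x = n}
        = {x \<in> S i. w x = n} \<union> {x \<in> (\<Union>j\<in>I. S j). w x = n}" by auto
    then show "finite {x \<in> S i \<union> (\<Union>j\<in>I. S j). w x = n}"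
      using gf by (simp only: graded_finite_def finite_Un)
  qed
  ultimately show ?case
    using insert gen_series_Un[of w "S i" "\<Union>j\<in>I. S j"] by simp
qed

lemma gen_series_image:
  assumes "inj_on F S" "\<And>x. x \<in> S \<Longrightarrow> w' (F x) = w x + m"
  shows "gen_series w' (F ` S) = fps_X ^ m * gen_series w S"
proof (rule fps_ext)
  fix n
  have "{y \<in> F ` S. w' y = n} = F ` {x \<in> S. w x + m = n}" using assms(2) by auto
  moreover have "card (F ` {x \<in> S. w x + m = n}) = card {x \<in> S. w x + m = n}"
    using assms(1) by (intro card_image) (auto simp: inj_on_def)
  moreover have "{x \<in> S. w x + m = n} = (if n < m then {} else {x \<in> S. w x = n - m})" by auto
  ultimately show "fps_nth (gen_series w' (F ` S)) n = fps_nth (fps_X ^ m * gen_series w S) n"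
    by (simp add: gen_series_def fps_X_power_mult_nth)
qed

lemma gen_series_Times:
  assumes "graded_finite w S" "graded_finite w' S'"
  shows "graded_finite (\<lambda>(x, y). w x + w' y) (S \<times> S') \<and>
    gen_series (\<lambda>(x, y). w x + w' y) (S \<times> S') = gen_series w S * gen_series w' S'"
proof -
  have eq: "{z \<in> S \<times> S'. (case z of (x, y) \<Rightarrow> w x + w' y) = n}
      = (\<Union>i\<in>{0..n}. {x \<in> S. w x = i} \<times> {y \<in> S'. w' y = n - i})" for n
    by auto
  have fin: "finite {x \<in> S. w x = i}" "finite {x \<in> S'. w' x = i}" for i
    using assms by (auto simp: graded_finite_def)
  have "card (\<Union>i\<in>{0..n}. {x \<in> S. w x = i} \<times> {y \<in> S'. w' y = n - i})
      = (\<Sum>i=0..n. card {x \<in> S. w x = i} * card {y \<in> S'. w' y = n - i})" for n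
    by (subst card_UN_disjoint) (auto simp: fin card_cartesian_product)
  then show ?thesis
    unfolding graded_finite_def eq
    by (auto simp: fin gen_series_def fps_eq_iff fps_mult_nth eq)
qed

text \<open>The list \<open>ms\<close> records the factors \<open>1 - z^m\<close> of the
  denominator. Exponent 0 has to be excluded: its factor is 0, and every series would qualify with
  \<open>p = 0\<close>. Over the rationals the coefficients of such a series eventually form a
  quasi-polynomial.\<close>

definition quasipoly_fps :: "'a::field fps \<Rightarrow> bool" where
  "quasipoly_fps f \<longleftrightarrow> (\<exists>ms p. 0 \<notin> set ms \<and>
     f * fps_of_poly (\<Prod>m\<leftarrow>ms. 1 - Polynomial.monom 1 m) = fps_of_poly p)"

lemma quasipoly_fps_add:
  assumes "quasipoly_fps f" "quasipoly_fps g" shows "quasipoly_fps (f + g)"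
proof -
  obtain ms p where f: "0 \<notin> set ms"
    "f * fps_of_poly (\<Prod>m\<leftarrow>ms. 1 - Polynomial.monom 1 m) = fps_of_poly p" (is "f * ?F = _")
    using assms(1) unfolding quasipoly_fps_def by blast
  obtain ns q where g: "0 \<notin> set ns"
    "g * fps_of_poly (\<Prod>m\<leftarrow>ns. 1 - Polynomial.monom 1 m) = fps_of_poly q" (is "g * ?G = _")
    using assms(2) unfolding quasipoly_fps_def by blast
  have "(f + g) * (?F * ?G) = (f * ?F) * ?G + (g * ?G) * ?F" by (simp add: algebra_simps)
  also have "\<dots> = fps_of_poly (p * (\<Prod>m\<leftarrow>ns. 1 - Polynomial.monom 1 m)
      + q * (\<Prod>m\<leftarrow>ms. 1 - Polynomial.monom 1 m))"
    by (simp add: f g fps_of_poly_mult fps_of_poly_add)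
  finally show ?thesis
    using f(1) g(1) unfolding quasipoly_fps_def
    by (intro exI[of _ "ms @ ns"]) (auto simp: fps_of_poly_mult)
qed

lemma quasipoly_fps_mult:
  assumes "quasipoly_fps f" "quasipoly_fps g" shows "quasipoly_fps (f * g)"
proof -
  obtain ms p where f: "0 \<notin> set ms"
    "f * fps_of_poly (\<Prod>m\<leftarrow>ms. 1 - Polynomial.monom 1 m) = fps_of_poly p" (is "f * ?F = _")
    using assms(1) unfolding quasipoly_fps_def by blast
  obtain ns q where g: "0 \<notin> set ns"
    "g * fps_of_poly (\<Prod>m\<leftarrow>ns. 1 - Polynomial.monom 1 m) = fps_of_poly q" (is "g * ?G = _")
    using assms(2) unfolding quasipoly_fps_def by blast
  have "(f * g) * (?F * ?G) = (f * ?F) * (g * ?G)" by (simp add: algebra_simps)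
  also have "\<dots> = fps_of_poly (p * q)" by (simp add: f g fps_of_poly_mult)
  finally show ?thesis
    using f(1) g(1) unfolding quasipoly_fps_def
    by (intro exI[of _ "ms @ ns"]) (auto simp: fps_of_poly_mult)
qed

lemma quasipoly_fps_of_poly: "quasipoly_fps (fps_of_poly p)"
  unfolding quasipoly_fps_def by (intro exI[of _ "[]"]) auto

lemma quasipoly_fps_0: "quasipoly_fps 0" and quasipoly_fps_1: "quasipoly_fps 1"
  using quasipoly_fps_of_poly[of 0] quasipoly_fps_of_poly[of 1] by simp_all

lemma quasipoly_fps_X_power: "quasipoly_fps (fps_X ^ m)"
  using quasipoly_fps_of_poly[of "Polynomial.monom 1 m"] by (simp add: fps_of_poly_monom')

lemma quasipoly_fps_sum: "(\<And>i. i \<in> I \<Longrightarrow> quasipoly_fps (f i)) \<Longrightarrow> quasipoly_fps (\<Sum>i\<in>I. f i)"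
  by (induction I rule: infinite_finite_induct) (auto intro: quasipoly_fps_add quasipoly_fps_0)

lemma quasipoly_fps_fixpoint:
  assumes "f = g + fps_X ^ m * f" "quasipoly_fps g" "m > 0"
  shows "quasipoly_fps f"
proof -
  obtain ms p where g: "0 \<notin> set ms"
    "g * fps_of_poly (\<Prod>m\<leftarrow>ms. 1 - Polynomial.monom 1 m) = fps_of_poly p"
    using assms(2) unfolding quasipoly_fps_def by blast
  have "f * (1 - fps_X ^ m) = g" using assms(1) by (simp add: algebra_simps)
  then have "f * fps_of_poly (\<Prod>m\<leftarrow>m # ms. 1 - Polynomial.monom 1 m) = fps_of_poly p"
    using g(2) by (simp add: fps_of_poly_mult fps_of_poly_diff fps_of_poly_monom' mult.assoc[symmetric])
  then show ?thesis
    using g(1) assms(3) unfolding quasipoly_fps_def by (intro exI[of _ "m # ms"]) auto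
qed

lemma quasipoly_fps_imp_rational:
  assumes "quasipoly_fps f" shows "rational_fps f"
proof -
  obtain ms p where f: "0 \<notin> set ms"
    "f * fps_of_poly (\<Prod>m\<leftarrow>ms. 1 - Polynomial.monom 1 m) = fps_of_poly p" (is "f * fps_of_poly ?q = _")
    using assms unfolding quasipoly_fps_def by blast
  have "poly ?q 0 \<noteq> 0" using f(1)
    by (induction ms) (auto simp: poly_monom power_0_left)
  moreover from this have "?q \<noteq> 0" by (metis poly_0)
  then have "f = fps_of_poly p / fps_of_poly ?q"
    unfolding f(2)[symmetric] by simp
  ultimately show ?thesis unfolding rational_fps_def by blast
qed

section \<open>Coefficient growth when all poles are roots of unity\<close>

lemma one_minus_monom_dvd:
  assumes "m dvd n" shows "(1 - Polynomial.monom 1 m :: 'a::comm_ring_1 poly) dvd 1 - Polynomial.monom 1 n"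
proof -
  obtain t where "n = m * t" using assms by blast
  then have "Polynomial.monom 1 n = (Polynomial.monom 1 m :: 'a poly) ^ t"
    by (simp add: monom_power)
  then show ?thesis by (simp add: one_diff_power_eq)
qed

text \<open>The binomial coefficients make the discrete antiderivative in this induction a mere index shift.\<close>

lemma binomial_form_of_pole_order:
  fixes f :: "'a::field_char_0 fps"
  assumes "M > 0" "f * (1 - fps_X ^ M) ^ k = fps_of_poly p"
  shows "\<exists>c N. \<forall>j\<ge>N. fps_nth f (r + M * j) = (\<Sum>i<k. c i * of_nat (j choose i))"
  using assms(2)
proof (induction k arbitrary: f r)
  case 0
  have "r + M * j > degree p" if "j \<ge> Suc (degree p)" for j
    using that mult_le_mono1[of 1 M j] assms(1) by linarith
  then have "\<forall>j\<ge>Suc (degree p). fps_nth f (r + M * j) = 0"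
    using 0 by (simp add: coeff_eq_0)
  then show ?case by auto
next
  case (Suc k)
  define g where "g = f * (1 - fps_X ^ M)"
  have "g * (1 - fps_X ^ M) ^ k = fps_of_poly p" using Suc.prems by (simp add: g_def mult_ac)
  \<comment> \<open>Along a progression of step \<open>M\<close>, the factor
    \<open>1 - fps_X ^ M\<close> is a difference operator: the coefficients of \<open>g\<close> are
    the increments of those of \<open>f\<close>. The increment towards index
    \<open>r + M * Suc j\<close> sits at \<open>r + M + M * j\<close>, so the induction hypothesis
    is used for the offset \<open>r + M\<close>, which need not be below \<open>M\<close>.\<close>
  from Suc.IH[OF this, of "r + M"] obtain c N where
    c: "\<And>j. j \<ge> N \<Longrightarrow> fps_nth g (r + M + M * j) = (\<Sum>i<k. c i * of_nat (j choose i))" by blast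
  have rec: "fps_nth f (r + M * Suc j) = fps_nth f (r + M * j) + fps_nth g (r + M + M * j)" for j
  proof -
    have "fps_nth g (r + M + M * j) = fps_nth f (r + M + M * j) - fps_nth (f * fps_X ^ M) (r + M + M * j)"
      by (simp add: g_def right_diff_distrib)
    also have "fps_nth (f * fps_X ^ M) (r + M + M * j) = fps_nth f (r + M * j)"
      by (simp add: fps_mult_fps_X_power_nonzero(2) fps_X_power_mult_right_nth)
    finally show ?thesis by (simp add: algebra_simps)
  qed
  \<comment> \<open>The constant of summation, chosen to make the formula true at \<open>N\<close>;
    Pascal's rule carries it from \<open>j\<close> to \<open>Suc j\<close>.\<close>
  define C where "C = fps_nth f (r + M * N) - (\<Sum>i<k. c i * of_nat (N choose Suc i))"
  have "fps_nth f (r + M * j) = C + (\<Sum>i<k. c i * of_nat (j choose Suc i))" if "j \<ge> N" for j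
    using that
  proof (induction j rule: dec_induct)
    case base
    then show ?case by (simp add: C_def)
  next
    case (step j)
    then show ?case
      by (simp only: rec c) (simp add: sum.distrib algebra_simps)
  qed
  then have "\<forall>j\<ge>N. fps_nth f (r + M * j) = (\<Sum>i<Suc k. (case i of 0 \<Rightarrow> C | Suc i \<Rightarrow> c i) * of_nat (j choose i))"
    unfolding sum.lessThan_Suc_shift by simp
  then show ?case by blast
qed

lemma binomial_over_power_tendsto: "(\<lambda>j. real (j choose i) / real j ^ i) \<longlonglongrightarrow> 1 / fact i"
proof (induction i)
  case 0
  then show ?case by simp
next
  case (Suc i)
  have "(\<lambda>j. real (j choose i) / real j ^ i * ((1 - real i / real j) / real (Suc i)))
      \<longlonglongrightarrow> 1 / fact i * ((1 - 0) / real (Suc i))"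
    by (intro tendsto_intros Suc lim_const_over_n) auto
  moreover have "\<forall>\<^sub>F j in sequentially. real (j choose i) / real j ^ i * ((1 - real i / real j) / real (Suc i))
      = real (j choose Suc i) / real j ^ Suc i"
    using eventually_gt_at_top[of i]
  proof eventually_elim
    case (elim j)
    have "(j choose Suc i) * Suc i = (j choose i) * (j - i)"
      using binomial_absorption[of i j] binomial_absorb_comp[of j i] by (simp add: mult.commute)
    then have "real (j choose Suc i) * real (Suc i) = real (j choose i) * (real j - real i)"
      using elim by (metis less_imp_le_nat of_nat_diff of_nat_mult)
    then have "real (j choose Suc i) = real (j choose i) * (real j - real i) / real (Suc i)"
      by (simp add: eq_divide_eq)
    moreover have "1 - real i / real j = (real j - real i) / real j"
      using elim by (simp add: diff_divide_distrib)
    ultimately show ?case by (simp only: times_divide_times_eq power_Suc divide_divide_eq_left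
        divide_divide_eq_right times_divide_eq_right times_divide_eq_left mult_ac)
  qed
  ultimately have "(\<lambda>j. real (j choose Suc i) / real j ^ Suc i)
      \<longlonglongrightarrow> 1 / fact i * ((1 - 0) / real (Suc i))"
    by (rule Lim_transform_eventually)
  then show ?case by (simp add: mult.commute)
qed

text \<open>Since \<open>j choose i\<close> has order \<open>j ^ i\<close>, the last nonzero
  coefficient decides. A vanishing top coefficient is dropped by induction on
  \<open>k\<close>.\<close>

lemma binomial_sum_asymptotics:
  fixes c :: "nat \<Rightarrow> real"
  shows "(\<forall>j. (\<Sum>i<k. c i * real (j choose i)) = 0) \<or>
    (\<exists>d L. L \<noteq> 0 \<and> (\<lambda>j. (\<Sum>i<k. c i * real (j choose i)) / real j ^ d) \<longlonglongrightarrow> L)"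
proof (induction k)
  case 0
  then show ?case by simp
next
  case (Suc k)
  show ?case
  proof (cases "c k = 0")
    case True
    then show ?thesis using Suc by simp
  next
    case False
    have lower: "(\<lambda>j. c i * (real (j choose i) / real j ^ k)) \<longlonglongrightarrow> 0" if "i < k" for i
    proof -
      have "(\<lambda>j. 1 / real j ^ (k - i)) \<longlonglongrightarrow> 0" using that
        by (intro tendsto_divide_0[OF tendsto_const] filterlim_at_top_imp_at_infinity
            filterlim_pow_at_top filterlim_real_sequentially) auto
      from tendsto_mult[OF tendsto_const[of "c i"] tendsto_mult[OF binomial_over_power_tendsto[of i] this]]
      have "(\<lambda>j. c i * (real (j choose i) / real j ^ i * (1 / real j ^ (k - i)))) \<longlonglongrightarrow> 0"
        by simp
      moreover have "real j ^ i * real j ^ (k - i) = real j ^ k" for j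
        using that by (simp flip: power_add)
      ultimately show ?thesis by simp
    qed
    have "(\<lambda>j. (\<Sum>i<k. c i * (real (j choose i) / real j ^ k))
        + c k * (real (j choose k) / real j ^ k)) \<longlonglongrightarrow> (\<Sum>i<k. 0) + c k * (1 / fact k)"
      by (intro tendsto_add tendsto_sum tendsto_mult[OF tendsto_const binomial_over_power_tendsto] lower) auto
    then have "(\<lambda>j. (\<Sum>i<Suc k. c i * real (j choose i)) / real j ^ k) \<longlonglongrightarrow> c k / fact k"
      by (simp add: sum_divide_distrib add_divide_distrib)
    then show ?thesis using False by (intro disjI2 exI[of _ k] exI[of _ "c k / fact k"]) auto
  qed
qed

text \<open>The limsup is decided by the residue classes of largest exponent: classes with a smaller
  one stay bounded after division by the larger power, and vanishing classes contribute nothing. The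
  limits may differ from class to class, so only the limsup of the merged sequence is
  controlled.\<close>

lemma polynomial_growth_of_residues:
  fixes a :: "nat \<Rightarrow> real"
  assumes M: "M > 0" and nonneg: "\<And>n. a n \<ge> 0"
    and res: "\<And>r. (\<forall>\<^sub>F j in sequentially. a (r + M * j) = 0) \<or>
      (\<exists>d L. L \<noteq> 0 \<and> (\<lambda>j. a (r + M * j) / real j ^ d) \<longlonglongrightarrow> L)"
  shows "polynomial_growth a"
proof -
  define Z where "Z = {r. r < M \<and> (\<forall>\<^sub>F j in sequentially. a (r + M * j) = 0)}"
  define R where "R = {..<M} - Z"
  have "\<forall>r\<in>R. \<exists>d L. L \<noteq> 0 \<and> (\<lambda>j. a (r + M * j) / real j ^ d) \<longlonglongrightarrow> L"
    using res by (auto simp: R_def Z_def)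
  then obtain d L where dL: "\<And>r. r \<in> R \<Longrightarrow> L r \<noteq> 0"
      "\<And>r. r \<in> R \<Longrightarrow> (\<lambda>j. a (r + M * j) / real j ^ d r) \<longlonglongrightarrow> L r"
    by metis
  have Lpos: "L r > 0" if "r \<in> R" for r
    using dL[OF that] LIMSEQ_le_const[OF dL(2)[OF that], of 0] nonneg
    by (smt (verit, best) divide_nonneg_nonneg of_nat_0_le_iff zero_le_power)
  have cover: "n mod M < M \<and> n = n mod M + M * (n div M)" for n using M by simp
  have by_residue: "\<forall>\<^sub>F n in sequentially. P n"
    if "\<And>r. r < M \<Longrightarrow> \<forall>\<^sub>F j in sequentially. P (r + M * j)" for P
  proof -
    have "\<forall>\<^sub>F j in sequentially. \<forall>r\<in>{..<M}. P (r + M * j)"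
      by (rule eventually_ball_finite) (use that in auto)
    then obtain J where J: "\<And>j r. j \<ge> J \<Longrightarrow> r < M \<Longrightarrow> P (r + M * j)"
      by (auto simp: eventually_sequentially)
    have "P n" if "n \<ge> J * M" for n
      using J[of "n div M" "n mod M"] cover[of n] that M
      by (metis div_le_mono div_mult_self_is_m mult.commute)
    then show ?thesis by (auto simp: eventually_sequentially)
  qed
  show ?thesis
  proof (cases "R = {}")
    case True
    have "\<forall>\<^sub>F n in sequentially. a n = 0"
    proof (rule by_residue)
      fix r assume "r < M"
      then have "r \<in> Z" using True by (auto simp: R_def)
      then show "\<forall>\<^sub>F j in sequentially. a (r + M * j) = 0" by (simp add: Z_def)
    qed
    then show ?thesis by (auto simp: polynomial_growth_def eventually_sequentially)
  next
    case False
    have finR: "finite R" by (simp add: R_def)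
    define D where "D = Max (d ` R)"
    obtain r0 where r0: "r0 \<in> R" "d r0 = D"
      using Max_in[of "d ` R"] finR False unfolding D_def[symmetric] by blast
    \<comment> \<open>All \<open>L r\<close> are positive, so the sum bounds each single
      \<open>L r + 1\<close> and serves every residue at once.\<close>
    define K where "K = (\<Sum>r\<in>R. L r + 1)"
    have upper: "\<forall>\<^sub>F n in sequentially. a n / real n ^ D \<le> K"
    proof (rule by_residue)
      fix r assume r: "r < M"
      show "\<forall>\<^sub>F j in sequentially. a (r + M * j) / real (r + M * j) ^ D \<le> K"
      proof (cases "r \<in> R")
        case False
        then have "\<forall>\<^sub>F j in sequentially. a (r + M * j) = 0" using r by (auto simp: R_def Z_def)
        moreover have "K \<ge> 0" unfolding K_def using Lpos by (intro sum_nonneg) force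
        ultimately show ?thesis by (auto elim: eventually_mono)
      next
        case True
        have "L r + 1 \<le> K" unfolding K_def
          by (rule member_le_sum) (use True finR Lpos in force)+
        have "d r \<le> D" unfolding D_def using True finR by simp
        have "\<forall>\<^sub>F j in sequentially. a (r + M * j) / real j ^ d r < L r + 1"
          using dL(2)[OF True] by (rule order_tendstoD) simp
        then show ?thesis using eventually_gt_at_top[of 0]
        proof eventually_elim
          case (elim j)
          have "real j \<le> real (r + M * j)"
            using mult_le_mono1[of 1 M j] M by linarith
          then have "real j ^ d r \<le> real (r + M * j) ^ d r" by (intro power_mono) auto
          also have "\<dots> \<le> real (r + M * j) ^ D"
            using \<open>d r \<le> D\<close> \<open>real j \<le> _\<close> elim(2) by (intro power_increasing) auto
          finally have "a (r + M * j) / real (r + M * j) ^ D \<le> a (r + M * j) / real j ^ d r"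
            using nonneg elim(2) \<open>real j \<le> _\<close> M
            by (intro divide_left_mono mult_pos_pos zero_less_power) (simp_all del: of_nat_add of_nat_mult)
          then show ?case using elim(1) \<open>L r + 1 \<le> K\<close> by linarith
        qed
      qed
    qed
    \<comment> \<open>For \<open>j > r0\<close> the index \<open>r0 + M * j\<close> is at most
      \<open>(M + 1) * j\<close>, so replacing \<open>j ^ D\<close> by
      \<open>(r0 + M * j) ^ D\<close> costs at most the factor \<open>(M + 1) ^ D\<close>. Half of
      \<open>L r0\<close> is an eventual lower bound before that replacement.\<close>
    define c where "c = L r0 / 2 / (real M + 1) ^ D"
    have "c > 0" using Lpos[OF r0(1)] M by (simp add: c_def)
    have "\<forall>\<^sub>F j in sequentially. c \<le> a (r0 + M * j) / real (r0 + M * j) ^ D"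
    proof -
      have "\<forall>\<^sub>F j in sequentially. a (r0 + M * j) / real j ^ D > L r0 / 2"
        using dL(2)[OF r0(1)] Lpos[OF r0(1)] unfolding r0(2) by (intro order_tendstoD) auto
      then show ?thesis using eventually_gt_at_top[of r0]
      proof eventually_elim
        case (elim j)
        have "real (r0 + M * j) \<le> (real M + 1) * real j" using elim(2) by (simp add: algebra_simps)
        then have "real (r0 + M * j) ^ D \<le> (real M + 1) ^ D * real j ^ D"
          by (metis of_nat_0_le_iff power_mono power_mult_distrib)
        then have "a (r0 + M * j) / ((real M + 1) ^ D * real j ^ D) \<le> a (r0 + M * j) / real (r0 + M * j) ^ D"
          using nonneg elim(2) M
          by (intro divide_left_mono mult_pos_pos zero_less_power) (auto simp: add_nonneg_pos)
        moreover have "c \<le> a (r0 + M * j) / real j ^ D / (real M + 1) ^ D"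
          unfolding c_def using elim(1) by (intro divide_right_mono) auto
        ultimately show ?case by (simp add: mult.commute)
      qed
    qed
    then have freq: "\<exists>\<^sub>F n in sequentially. c \<le> a n / real n ^ D"
    proof -
      obtain J where J: "\<And>j. j \<ge> J \<Longrightarrow> c \<le> a (r0 + M * j) / real (r0 + M * j) ^ D"
        using \<open>\<forall>\<^sub>F j in sequentially. c \<le> _ j\<close> by (auto simp: eventually_sequentially)
      have "\<exists>n\<ge>m. c \<le> a n / real n ^ D" for m
        using J[of "max J m"] mult_le_mono1[of 1 M "max J m"] M
        by (intro exI[of _ "r0 + M * max J m"]) auto
      then show ?thesis by (auto simp: frequently_sequentially)
    qed
    have "limsup (\<lambda>n. ereal (a n / real n ^ D)) \<le> ereal K"
      by (rule Limsup_bounded) (use upper in \<open>auto elim: eventually_mono\<close>)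
    moreover have "ereal c \<le> limsup (\<lambda>n. ereal (a n / real n ^ D))"
    proof (rule ccontr)
      assume "\<not> ?thesis"
      then have "\<forall>\<^sub>F n in sequentially. ereal (a n / real n ^ D) < ereal c"
        by (intro Limsup_lessD) auto
      then show False using freq
        by (simp add: frequently_def not_le)
    qed
    ultimately show ?thesis
      unfolding polynomial_growth_def using \<open>c > 0\<close>
      by (intro disjI2 exI[of _ D] conjI)
        (auto intro: order_less_le_trans[of _ "ereal c"] order_le_less_trans[of _ "ereal K"])
  qed
qed

lemma quasipoly_fps_imp_polynomial_growth:
  fixes a :: "nat \<Rightarrow> nat"
  assumes "quasipoly_fps (Abs_fps (\<lambda>n. of_nat (a n)) :: rat fps)" (is "quasipoly_fps ?f")
  shows "polynomial_growth (\<lambda>n. real (a n))"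
proof -
  obtain ms p where f: "0 \<notin> set ms"
    "?f * fps_of_poly (\<Prod>m\<leftarrow>ms. 1 - Polynomial.monom 1 m) = fps_of_poly p"
    using assms unfolding quasipoly_fps_def by blast
  \<comment> \<open>With a common multiple of the exponents, the product of the different factors
    divides one power of \<open>1 - z^M\<close>; the cofactor \<open>q\<close> is absorbed into the
    numerator.\<close>
  define M where "M = prod_list ms"
  have M: "M > 0" using f(1) prod_list_zero_iff[of ms] unfolding M_def by (intro gr0I) blast
  have "\<forall>m\<in>set ms. m dvd M" unfolding M_def by (simp add: prod_list_dvd)
  then have "(\<Prod>m\<leftarrow>ms. 1 - Polynomial.monom 1 m :: rat poly)
      dvd (1 - Polynomial.monom 1 M) ^ length ms"
    by (induction ms) (auto intro!: mult_dvd_mono one_minus_monom_dvd)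
  then obtain q where q: "(1 - Polynomial.monom 1 M :: rat poly) ^ length ms
      = (\<Prod>m\<leftarrow>ms. 1 - Polynomial.monom 1 m) * q" by blast
  have "?f * (1 - fps_X ^ M) ^ length ms = ?f * fps_of_poly ((1 - Polynomial.monom 1 M) ^ length ms)"
    by (simp add: fps_of_poly_power fps_of_poly_diff fps_of_poly_monom')
  also have "\<dots> = fps_of_poly (p * q)"
    unfolding q fps_of_poly_mult mult.assoc[symmetric] f(2) ..
  finally have eq: "?f * (1 - fps_X ^ M) ^ length ms = fps_of_poly (p * q)" .
  show ?thesis
  proof (rule polynomial_growth_of_residues[OF M])
    fix r
    obtain c N where c: "\<forall>j\<ge>N. (of_nat (a (r + M * j)) :: rat)
        = (\<Sum>i<length ms. c i * of_nat (j choose i))"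
      using binomial_form_of_pole_order[OF M eq, of r] by auto
    have c': "real (a (r + M * j)) = (\<Sum>i<length ms. of_rat (c i) * real (j choose i))" if "j \<ge> N" for j
    proof -
      have "real (a (r + M * j)) = of_rat (of_nat (a (r + M * j)))" by simp
      also have "\<dots> = (\<Sum>i<length ms. of_rat (c i) * real (j choose i))"
        using that c by (simp only:) (simp add: of_rat_sum of_rat_mult)
      finally show ?thesis .
    qed
    then have ev: "\<forall>\<^sub>F j in sequentially.
        real (a (r + M * j)) = (\<Sum>i<length ms. of_rat (c i) * real (j choose i))"
      by (auto simp: eventually_sequentially)
    then have ev': "\<forall>\<^sub>F j in sequentially. real (a (r + M * j)) / real j ^ d
        = (\<Sum>i<length ms. of_rat (c i) * real (j choose i)) / real j ^ d" for d
      by (auto elim: eventually_mono)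
    show "(\<forall>\<^sub>F j in sequentially. real (a (r + M * j)) = 0) \<or>
      (\<exists>d L. L \<noteq> 0 \<and> (\<lambda>j. real (a (r + M * j)) / real j ^ d) \<longlonglongrightarrow> L)"
      using binomial_sum_asymptotics[of "\<lambda>i. of_rat (c i)" "length ms"]
    proof (elim disjE)
      assume "\<forall>j. (\<Sum>i<length ms. of_rat (c i) * real (j choose i)) = 0"
      then show ?thesis using ev by (auto elim: eventually_mono)
    qed (use tendsto_cong[OF ev'] in blast)
  qed simp
qed


section \<open>Regular families of trees\<close>

lemma arity_pos: "tree_monomial \<Upsilon> ar t \<Longrightarrow> arity t > 0"
proof (induction t)
  case (Node g ts)
  then obtain u us where "ts = u # us" by (cases ts) auto
  then show ?case using Node by auto
qed simp

lemma sum_list_map_update: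
  fixes f :: "'x \<Rightarrow> nat"
  shows "i < length xs \<Longrightarrow> sum_list (map f (xs[i := x])) + f (xs ! i) = sum_list (map f xs) + f x"
proof (induction xs arbitrary: i)
  case (Cons y xs)
  then show ?case by (cases i) auto
qed simp

lemma arity_update:
  "i < length ts \<Longrightarrow> arity (Node g (ts[i := u])) + arity (ts ! i) = arity (Node g ts) + arity u"
  using sum_list_map_update[of i ts arity u] by simp

lemma arity_nth_le: "i < length ts \<Longrightarrow> arity (ts ! i) \<le> arity (Node g ts)"
  by (simp add: member_le_sum_list)

lemma size_update: "i < length ts \<Longrightarrow> size u < size (Node g (ts[i := u]))"
  using set_update_memI[of i ts u] by (simp add: size_list_estimation' less_Suc_eq_le)

text \<open>Lists of children with prescribed states form a product of sets on which the weights
  add, so the series multiply.\<close>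

lemma gen_series_lists:
  assumes "\<And>q. q \<in> set qs \<Longrightarrow> graded_finite w (T q)"
  shows "graded_finite (\<lambda>ts. sum_list (map w ts)) {ts. list_all2 (\<lambda>t q. t \<in> T q) ts qs} \<and>
    gen_series (\<lambda>ts. sum_list (map w ts)) {ts. list_all2 (\<lambda>t q. t \<in> T q) ts qs}
      = (\<Prod>q\<leftarrow>qs. gen_series w (T q))"
  using assms
proof (induction qs)
  case Nil
  have "gen_series (\<lambda>ts. sum_list (map w ts)) {[]} = 1"
    using gen_series_singleton[of "\<lambda>ts. sum_list (map w ts)" "[]"] by simp
  then show ?case by (simp add: graded_finite_def)
next
  case (Cons q qs)
  let ?w = "\<lambda>ts. sum_list (map w ts)"
  let ?L = "{ts. list_all2 (\<lambda>t q. t \<in> T q) ts qs}"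
  let ?C = "\<lambda>(x, xs). x # xs"
  have eq: "{ts. list_all2 (\<lambda>t q. t \<in> T q) ts (q # qs)} = ?C ` (T q \<times> ?L)"
    by (auto simp: list_all2_Cons2)
  have inj: "inj_on ?C (T q \<times> ?L)" by (auto simp: inj_on_def)
  note times = gen_series_Times[of w "T q" ?w ?L]
  have gf: "graded_finite w (T q)" "graded_finite ?w ?L" using Cons by auto
  have "gen_series ?w (?C ` (T q \<times> ?L)) = fps_X ^ 0 * gen_series (\<lambda>(x, y). w x + ?w y) (T q \<times> ?L)"
    by (rule gen_series_image[OF inj]) auto
  then have "gen_series ?w {ts. list_all2 (\<lambda>t q. t \<in> T q) ts (q # qs)}
      = (\<Prod>q\<leftarrow>q # qs. gen_series w (T q))"
    unfolding eq using Cons times gf by simp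
  moreover have "graded_finite ?w (?C ` (T q \<times> ?L))"
    unfolding graded_finite_def
  proof
    fix n
    have "{y \<in> ?C ` (T q \<times> ?L). ?w y = n} = ?C ` {z \<in> T q \<times> ?L. (case z of (x, y) \<Rightarrow> w x + ?w y) = n}"
      by auto
    then show "finite {y \<in> ?C ` (T q \<times> ?L). ?w y = n}"
      using times gf by (simp only: graded_finite_def) blast
  qed
  ultimately show ?case unfolding eq by simp
qed

text \<open>A finite deterministic bottom-up tree automaton in Myhill-Nerode form. There is no
  transition table; instead \<open>congruence\<close> lets children be exchanged for trees of the
  same state without leaving \<open>N\<close> or changing the state at the root. Pumping rests on
  this exchange.\<close>

locale regular_tree_family =
  fixes \<Upsilon> :: "'g set" and ar :: "'g \<Rightarrow> nat" and N :: "'g ptree set" and st :: "'g ptree \<Rightarrow> 'q"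
  assumes finite_gens: "finite \<Upsilon>"
    and monomials: "N \<subseteq> {t. tree_monomial \<Upsilon> ar t}"
    and finite_states: "finite (st ` N)"
    and children: "Node g ts \<in> N \<Longrightarrow> set ts \<subseteq> N"
    and congruence: "Node g ts \<in> N \<Longrightarrow> list_all2 (\<lambda>t u. u \<in> N \<and> st t = st u) ts us
      \<Longrightarrow> Node g us \<in> N \<and> st (Node g us) = st (Node g ts)"
    and graded: "graded_finite arity N"
    and subexp: "subexponential_growth (\<lambda>n. real (card {t \<in> N. arity t = n}))"
begin

definition trees :: "'q \<Rightarrow> 'g ptree set" where "trees q = {t \<in> N. st t = q}"

text \<open>Edges run from the state of a child to the state of its parent. Given
  \<open>child p q\<close>, the condition \<open>child\<^sup>*\<^sup>* q p\<close> thus says that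
  \<open>p\<close> and \<open>q\<close> lie in the same strongly connected component.\<close>

definition child :: "'q \<Rightarrow> 'q \<Rightarrow> bool" where
  "child p q \<longleftrightarrow> (\<exists>g ts. Node g ts \<in> trees q \<and> p \<in> st ` set ts)"

text \<open>\<open>F\<close> behaves like filling the hole of a one-hole tree context with \<open>m\<close> further leaves.\<close>

definition context_map :: "'q \<Rightarrow> 'q \<Rightarrow> nat \<Rightarrow> ('g ptree \<Rightarrow> 'g ptree) \<Rightarrow> bool" where
  "context_map p q m F \<longleftrightarrow> inj_on F (trees p) \<and>
     (\<forall>u\<in>trees p. F u \<in> trees q \<and> arity (F u) = arity u + m \<and> size u < size (F u))"

lemma graded_trees: "graded_finite arity (trees q)"
  by (rule graded_finite_subset[OF graded]) (auto simp: trees_def)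

lemma context_map_comp:
  assumes "context_map p q m F" "context_map q s n H" shows "context_map p s (m + n) (H \<circ> F)"
proof -
  have "inj_on (H \<circ> F) (trees p)"
  proof (rule comp_inj_on)
    have "F ` trees p \<subseteq> trees q" using assms(1) by (auto simp: context_map_def)
    then show "inj_on H (F ` trees p)"
      using assms(2) inj_on_subset unfolding context_map_def by blast
  qed (use assms(1) in \<open>simp add: context_map_def\<close>)
  then show ?thesis using assms by (fastforce simp: context_map_def)
qed

lemma context_map_pow:
  assumes "context_map q q m F" "k > 0" shows "context_map q q (m * k) (F ^^ k)"
  using assms(2)
proof (induction k rule: nat_induct_non_zero)
  case 1
  then show ?case using assms(1) by simp
next
  case (Suc k)
  have "context_map q q (m * k + m) (F \<circ> F ^^ k)" by (rule context_map_comp[OF Suc.IH assms(1)])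
  then show ?case by (simp add: add.commute comp_def)
qed

lemma plug:
  assumes "Node g ts \<in> trees q" "i < length ts" "u \<in> trees (st (ts ! i))"
  shows "Node g (ts[i := u]) \<in> trees q"
proof -
  have "list_all2 (\<lambda>t u. u \<in> N \<and> st t = st u) ts (ts[i := u])"
    using assms children[of g ts]
    by (auto simp: list_all2_conv_all_nth nth_list_update trees_def)
  then show ?thesis using congruence[of g ts] assms(1) by (auto simp: trees_def)
qed

lemma context_map_plug:
  assumes "Node g ts \<in> trees q" "i < length ts"
  shows "context_map (st (ts ! i)) q (arity (Node g ts) - arity (ts ! i)) (\<lambda>u. Node g (ts[i := u]))"
  unfolding context_map_def
proof (intro conjI ballI)
  show "inj_on (\<lambda>u. Node g (ts[i := u])) (trees (st (ts ! i)))"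
    by (rule inj_onI) (metis assms(2) nth_list_update_eq ptree.inject)
  fix u assume "u \<in> trees (st (ts ! i))"
  then show "Node g (ts[i := u]) \<in> trees q" using plug assms by blast
  show "arity (Node g (ts[i := u])) = arity u + (arity (Node g ts) - arity (ts ! i))"
    using arity_update[OF assms(2), of g u] arity_nth_le[OF assms(2), of g] by linarith
  show "size u < size (Node g (ts[i := u]))" by (rule size_update[OF assms(2)])
qed

lemma child_context_map: "child p q \<Longrightarrow> \<exists>m F. context_map p q m F"
proof -
  assume "child p q"
  then obtain g ts i where "Node g ts \<in> trees q" "i < length ts" "p = st (ts ! i)"
    unfolding child_def by (auto simp: in_set_conv_nth)
  then show ?thesis using context_map_plug by blast
qed

lemma tranclp_child_context_map: "child\<^sup>+\<^sup>+ p q \<Longrightarrow> \<exists>m F. context_map p q m F"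
proof (induction rule: tranclp_induct)
  case (step q s)
  then show ?case using child_context_map[of q s] context_map_comp by blast
qed (rule child_context_map)

lemma child_nonempty: "child p q \<Longrightarrow> trees p \<noteq> {} \<and> trees q \<noteq> {}"
  unfolding child_def trees_def using children by blast

text \<open>A cycle of weight 0 would map the finite nonempty set of trees of one arity into itself
  and increase \<open>size\<close>, which is impossible at a largest tree.\<close>

lemma context_map_cycle_pos:
  assumes "context_map q q m F" "trees q \<noteq> {}" shows "m > 0"
proof (rule ccontr)
  assume "\<not> m > 0"
  then have m: "m = 0" by simp
  obtain t where t: "t \<in> trees q" using assms(2) by blast
  let ?A = "{u \<in> trees q. arity u = arity t}"
  have "finite ?A" using graded_trees by (auto simp: graded_finite_def)
  moreover have "?A \<noteq> {}" using t by auto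
  ultimately obtain u where u: "u \<in> ?A" "\<And>v. v \<in> ?A \<Longrightarrow> size v \<le> size u"
    using obtains_MAX[of ?A size] by (metis (no_types, lifting) Max_ge finite_imageI image_eqI)
  then have "F u \<in> ?A" "size u < size (F u)" using assms(1) m by (auto simp: context_map_def)
  then show False using u(2) by fastforce
qed

section \<open>Two ways around a cycle force exponential growth\<close>

lemma no_doubling:
  fixes f :: "nat \<Rightarrow> nat"
  assumes "\<And>n. real (f n) \<le> real (card {t \<in> N. arity t = n})"
    and dbl: "\<And>n. n \<ge> K \<Longrightarrow> 2 * f n \<le> f (n + M)" and "M > 0" "n0 \<ge> K" "n0 > 0" "f n0 > 0"
  shows False
proof -
  have pow: "2 ^ j \<le> f (n0 + j * M)" for j
  proof (induction j)
    case 0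
    then show ?case using assms by simp
  next
    case (Suc j)
    then show ?case using dbl[of "n0 + j * M"] \<open>n0 \<ge> K\<close> by (simp add: add_ac)
  qed
  \<comment> \<open>\<open>d\<close> is the \<open>2 * M\<close>-th root of 2: over \<open>j\<close>
    steps of length \<open>M\<close> the subexponential bound grows only by
    \<open>sqrt 2 ^ j\<close>, while \<open>f\<close> reaches at least \<open>2 ^ j\<close>.\<close>
  define d where "d = root M (sqrt 2)"
  have d: "d > 1" "d ^ M = sqrt 2" using \<open>M > 0\<close> by (simp_all add: d_def)
  obtain C where C: "C > 0" "\<And>n. n > 0 \<Longrightarrow> real (card {t \<in> N. arity t = n}) < C * d ^ n"
    using subexp d(1) unfolding subexponential_growth_def by blast
  have "sqrt 2 ^ j < C * d ^ n0" for j
  proof -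
    have "(2::real) ^ j \<le> real (f (n0 + j * M))" using pow[of j] by (metis of_nat_le_iff of_nat_numeral of_nat_power)
    also have "\<dots> < C * d ^ (n0 + j * M)" using C(2)[of "n0 + j * M"] assms(1)[of "n0 + j * M"] assms(5) by linarith
    also have "\<dots> = C * d ^ n0 * sqrt 2 ^ j"
      by (simp add: power_add power_mult mult.commute[of j] d(2))
    also have "(2::real) ^ j = sqrt 2 ^ j * sqrt 2 ^ j"
      by (simp flip: power_mult_distrib)
    finally show ?thesis by simp
  qed
  moreover have "\<exists>j. C * d ^ n0 < sqrt 2 ^ j" by (rule real_arch_pow) simp
  ultimately show False by (meson less_asym)
qed

text \<open>Suitable powers of two such maps raise the arity by the same amount, so disjoint images
  would make the number of trees double periodically.\<close>

lemma context_map_images_meet: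
  assumes F: "context_map q q m F" and H: "context_map q q n H" and ne: "trees q \<noteq> {}"
  shows "\<exists>u\<in>trees q. \<exists>v\<in>trees q. F u = H v \<and> arity (F u) > K"
proof (rule ccontr)
  assume no: "\<not> ?thesis"
  have mn: "m > 0" "n > 0" using context_map_cycle_pos F H ne by auto
  define F' H' M where "F' = F ^^ n" and "H' = H ^^ m" and "M = m * n"
  have F': "context_map q q M F'" and H': "context_map q q M H'"
    using context_map_pow[OF F mn(2)] context_map_pow[OF H mn(1)] by (simp_all add: F'_def H'_def M_def mult.commute)
  \<comment> \<open>Iterates have smaller images, so the disjointness of the images of
    \<open>F\<close> and \<open>H\<close> above arity \<open>K\<close> is inherited by
    \<open>F'\<close> and \<open>H'\<close>.\<close>
  have iter: "(E ^^ k) u \<in> E ` trees q" if E: "context_map q q l E" and "k > 0" "u \<in> trees q" for E k l u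
  proof -
    have "(E ^^ j) u \<in> trees q" for j
      using E \<open>u \<in> trees q\<close> by (induction j) (auto simp: context_map_def)
    moreover have "(E ^^ k) u = E ((E ^^ (k - 1)) u)"
      using \<open>k > 0\<close> by (cases k) auto
    ultimately show ?thesis by simp
  qed
  define f where "f k = card {t \<in> trees q. arity t = k}" for k
  have fin: "finite {t \<in> trees q. arity t = k}" for k
    using graded_trees by (auto simp: graded_finite_def)
  have dbl: "2 * f k \<le> f (k + M)" if "k \<ge> K" for k
  proof -
    let ?A = "{t \<in> trees q. arity t = k}"
    have disj: "F' ` ?A \<inter> H' ` ?A = {}"
    proof (rule ccontr)
      assume "F' ` ?A \<inter> H' ` ?A \<noteq> {}"
      then obtain a b where ab: "a \<in> ?A" "b \<in> ?A" "F' a = H' b" by blast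
      have "F' a \<in> F ` trees q" "H' b \<in> H ` trees q"
        using iter[OF F mn(2), of a] iter[OF H mn(1), of b] ab(1,2) by (simp_all add: F'_def H'_def)
      then obtain u v where "u \<in> trees q" "v \<in> trees q" "F u = F' a" "H v = F' a" using ab(3) by auto
      moreover have "arity (F' a) = k + M" using F' ab(1) by (simp add: context_map_def)
      then have "arity (F' a) > K" using \<open>k \<ge> K\<close> mn by (simp add: M_def trans_le_add1 le_less_trans)
      ultimately show False using no by metis
    qed
    have "inj_on F' ?A" "inj_on H' ?A"
      using F' H' unfolding context_map_def by (auto intro: inj_on_subset)
    then have "card (F' ` ?A) = f k" "card (H' ` ?A) = f k"
      unfolding f_def by (simp_all only: card_image)
    then have "2 * f k = card (F' ` ?A \<union> H' ` ?A)"
      using disj fin by (simp add: card_Un_disjoint)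
    also have "\<dots> \<le> f (k + M)"
      unfolding f_def using F' H' by (intro card_mono fin) (auto simp: context_map_def)
    finally show ?thesis .
  qed
  obtain t where t: "t \<in> trees q" using ne by blast
  \<comment> \<open>Doubling has to start at a tree of arity above \<open>K\<close>. Since
    \<open>m\<close> is positive, \<open>Suc K\<close> rounds of \<open>F\<close> supply
    one.\<close>
  have Kt: "context_map q q (m * Suc K) (F ^^ Suc K)" by (rule context_map_pow[OF F]) simp
  define t' where "t' = (F ^^ Suc K) t"
  have t': "t' \<in> trees q" "arity t' = arity t + m * Suc K" using Kt t unfolding t'_def context_map_def by auto
  have "m * Suc K \<ge> Suc K" using mn by (metis Suc_leI mult_le_mono1 nat_mult_1 One_nat_def)
  then have big: "arity t' > K" using t'(2) by linarith
  have pos: "f (arity t') > 0" unfolding f_def using t' fin by (auto simp: card_gt_0_iff)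
  show False
  proof (rule no_doubling[of f K M "arity t'"])
    show "real (f k) \<le> real (card {t \<in> N. arity t = k})" for k
      unfolding f_def using graded by (auto intro!: card_mono simp: graded_finite_def trees_def)
    show "M > 0" using mn by (simp add: M_def)
  qed (use dbl big pos in auto)
qed

text \<open>Two different productions that keep a state inside its strongly connected component give two
  pumping maps whose images meet in at most one tree.\<close>

lemma production_unique:
  assumes t: "Node g ts \<in> trees q" "i < length ts" "child\<^sup>*\<^sup>* q (st (ts ! i))"
    and t': "Node g' ts' \<in> trees q" "i' < length ts'" "child\<^sup>*\<^sup>* q (st (ts' ! i'))"
  shows "g' = g \<and> i' = i \<and> st (ts' ! i) = st (ts ! i) \<and> ts' = ts[i := ts' ! i]"
proof -
  \<comment> \<open>A production becomes a self-map of \<open>trees q\<close> by first building,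
    with \<open>c\<close>, a tree in the state of the chosen child from a tree in state
    \<open>q\<close>. If that child already has state \<open>q\<close>, the identity is taken; this
    case is separate because the identity does not increase the size and so is no context
    map.\<close>
  have pump: "\<exists>c m. context_map q q m (\<lambda>u. Node h (us[j := c u])) \<and> c ` trees q \<subseteq> trees (st (us ! j))"
    if us: "Node h us \<in> trees q" "j < length us" "child\<^sup>*\<^sup>* q (st (us ! j))" for h us j
  proof (cases "st (us ! j) = q")
    case True
    then have "context_map q q (arity (Node h us) - arity (us ! j)) (\<lambda>u. Node h (us[j := id u]))"
      using context_map_plug[OF us(1,2)] by simp
    then show ?thesis using True by (intro exI[of _ id]) auto
  next
    case False
    then have "child\<^sup>+\<^sup>+ q (st (us ! j))" using us(3) by (metis rtranclpD)
    then obtain m c where c: "context_map q (st (us ! j)) m c" using tranclp_child_context_map by blast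
    from context_map_comp[OF c context_map_plug[OF us(1,2)]] c show ?thesis
      by (intro exI[of _ c]) (auto simp: comp_def context_map_def)
  qed
  obtain c m where c: "context_map q q m (\<lambda>u. Node g (ts[i := c u]))" "c ` trees q \<subseteq> trees (st (ts ! i))"
    using pump[OF t] by blast
  obtain c' m' where c': "context_map q q m' (\<lambda>u. Node g' (ts'[i' := c' u]))" "c' ` trees q \<subseteq> trees (st (ts' ! i'))"
    using pump[OF t'] by blast
  \<comment> \<open>If the two maps fill different positions, a common value carries
    \<open>ts' ! i\<close> at position \<open>i\<close> and equals
    \<open>Node g (ts[i := ts' ! i])\<close>. Taking the arity of this one tree as threshold rules
    it out. Before the lengths are known to agree, \<open>ts' ! i\<close> may be unspecified, but
    any number is a legitimate threshold.\<close>
  obtain u v where uv: "u \<in> trees q" "v \<in> trees q" "Node g (ts[i := c u]) = Node g' (ts'[i' := c' v])"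
    and big: "arity (Node g (ts[i := c u])) > arity (Node g (ts[i := ts' ! i]))"
    using context_map_images_meet[OF c(1) c'(1), of "arity (Node g (ts[i := ts' ! i]))"] t(1) by blast
  have eq: "g' = g" "ts[i := c u] = ts'[i' := c' v]" using uv(3) by auto
  have len: "length ts' = length ts" using eq(2) by (metis length_list_update)
  have ii: "i' = i"
  proof (rule ccontr)
    assume "i' \<noteq> i"
    then have "c u = ts' ! i" using eq(2) t(2) by (metis nth_list_update_eq nth_list_update_neq)
    then show False using big by simp
  qed
  have "c u = c' v" using eq(2) t(2) t'(2) unfolding ii by (metis nth_list_update_eq)
  moreover have "c u \<in> trees (st (ts ! i))" "c' v \<in> trees (st (ts' ! i))" using c c' uv ii by auto
  ultimately have "st (ts' ! i) = st (ts ! i)" by (auto simp: trees_def)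
  \<comment> \<open>Away from position \<open>i\<close> both lists agree with the common value, so
    the siblings coincide as trees and not only in their states.\<close>
  moreover have "ts' = ts[i := ts' ! i]"
    using eq(2) unfolding ii by (metis list_update_id list_update_overwrite)
  ultimately show ?thesis using eq(1) ii by simp
qed

section \<open>Series equations over the strongly connected components\<close>

definition base :: "'q \<Rightarrow> 'g ptree set" where
  "base q = {t \<in> trees q. \<forall>g ts. t = Node g ts \<longrightarrow> (\<forall>p\<in>st ` set ts. \<not> child\<^sup>*\<^sup>* q p)}"

text \<open>A tree in \<open>base q\<close> is a leaf or leaves the component of \<open>q\<close> at
  its root. Such trees are sorted by root label and list of child states, and each class is a
  product of sets \<open>trees p\<close> with \<open>p\<close> strictly lower.\<close>

lemma base_quasipoly:
  assumes IH: "\<And>p. child p q \<Longrightarrow> \<not> child\<^sup>*\<^sup>* q p \<Longrightarrow> quasipoly_fps (gen_series arity (trees p))"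
  shows "quasipoly_fps (gen_series arity (base q))"
proof -
  define Pr where "Pr = {(g, map st ts) | g ts. Node g ts \<in> base q}"
  define D where "D = (\<lambda>(g, qs). Node g ` {ts. list_all2 (\<lambda>t p. t \<in> trees p) ts qs})"
  have child: "child p q" "\<not> child\<^sup>*\<^sup>* q p" if x: "(g, qs) \<in> Pr" and p: "p \<in> set qs" for g qs p
  proof -
    obtain ts where "Node g ts \<in> base q" "qs = map st ts" using x unfolding Pr_def by blast
    then have ts: "Node g ts \<in> base q" "p \<in> st ` set ts" using p by simp_all
    then show "\<not> child\<^sup>*\<^sup>* q p" unfolding base_def by blast
    show "child p q" using ts unfolding base_def child_def by blast
  qed
  \<comment> \<open>The label fixes the number of children, so finitely many labels and states leave
    finitely many productions.\<close>
  have Pr: "Pr \<subseteq> (SIGMA g:\<Upsilon>. {qs. set qs \<subseteq> st ` N \<and> length qs = ar g})"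
    unfolding Pr_def base_def trees_def using monomials children by fastforce
  have "finite Pr"
    by (rule finite_subset[OF Pr]) (use finite_gens finite_states finite_lists_length_eq in auto)
  have Deq: "(\<Union>x\<in>Pr. D x) = base q - {Leaf}"
  proof (intro set_eqI iffI)
    fix t assume "t \<in> (\<Union>x\<in>Pr. D x)"
    then obtain g ts us where t: "t = Node g us" and b: "Node g ts \<in> base q"
      and l: "list_all2 (\<lambda>t p. t \<in> trees p) us (map st ts)"
      by (auto simp: Pr_def D_def)
    have "list_all2 (\<lambda>t u. u \<in> N \<and> st t = st u) ts us" "map st us = map st ts"
      using l by (auto simp: list_all2_conv_all_nth trees_def intro: nth_equalityI)
    then have "Node g us \<in> trees q" "st ` set us = st ` set ts"
      using congruence[of g ts us] b by (auto simp: base_def trees_def simp flip: set_map)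
    then have "\<forall>p\<in>st ` set us. \<not> child\<^sup>*\<^sup>* q p" using b by (simp add: base_def)
    then show "t \<in> base q - {Leaf}" unfolding t base_def using \<open>Node g us \<in> trees q\<close> by simp
  next
    fix t assume "t \<in> base q - {Leaf}"
    then obtain g ts where t: "t = Node g ts" "Node g ts \<in> base q" by (cases t) auto
    moreover have "list_all2 (\<lambda>t p. t \<in> trees p) ts (map st ts)"
      using t children[of g ts] by (auto simp: list_all2_conv_all_nth trees_def base_def)
    ultimately show "t \<in> (\<Union>x\<in>Pr. D x)" unfolding Pr_def D_def by blast
  qed
  have D: "graded_finite arity (D x) \<and> quasipoly_fps (gen_series arity (D x))" if "x \<in> Pr" for x
  proof -
    obtain g qs where x: "x = (g, qs)" by (cases x)
    note lists = gen_series_lists[of qs arity trees, OF graded_trees]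
    have "gen_series arity (D x) = fps_X ^ 0 *
        gen_series (\<lambda>ts. sum_list (map arity ts)) {ts. list_all2 (\<lambda>t p. t \<in> trees p) ts qs}"
      unfolding D_def x case_prod_conv by (rule gen_series_image) (auto simp: inj_on_def)
    also have "\<dots> = (\<Prod>q\<leftarrow>qs. gen_series arity (trees q))" using lists by simp
    also have "quasipoly_fps \<dots>"
    proof -
      have "\<forall>p\<in>set qs. quasipoly_fps (gen_series arity (trees p))" using IH child x that by blast
      then show ?thesis by (induction qs) (auto intro: quasipoly_fps_1 quasipoly_fps_mult)
    qed
    finally have "quasipoly_fps (gen_series arity (D x))" .
    moreover have "D x \<subseteq> base q" using Deq that by blast
    then have "graded_finite arity (D x)"
      by (intro graded_finite_subset[OF graded_trees[of q]]) (auto simp: base_def)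
    ultimately show ?thesis by blast
  qed
  \<comment> \<open>Determinism: a tree has only one list of child states, so no tree is counted
    twice.\<close>
  have disj: "D x \<inter> D y = {}" if "x \<noteq> y" for x y
  proof (rule ccontr)
    assume "D x \<inter> D y \<noteq> {}"
    then obtain g ts where "g = fst x" "g = fst y" and
      l: "list_all2 (\<lambda>t p. t \<in> trees p) ts (snd x)" "list_all2 (\<lambda>t p. t \<in> trees p) ts (snd y)"
      by (auto simp: D_def split: prod.splits)
    moreover have "snd x = map st ts" "snd y = map st ts"
      using l by (auto simp: list_all2_conv_all_nth trees_def intro!: nth_equalityI)
    ultimately show False using that by (metis prod.expand)
  qed
  have "quasipoly_fps (gen_series arity (\<Union>x\<in>Pr. D x))"
    using gen_series_UN[OF \<open>finite Pr\<close>, of arity D] D disj by (simp add: quasipoly_fps_sum)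
  then have nl: "quasipoly_fps (gen_series arity (base q - {Leaf}))" by (simp add: Deq)
  show ?thesis
  proof (cases "Leaf \<in> base q")
    case True
    have gf: "graded_finite arity (base q)"
      by (rule graded_finite_subset[OF graded_trees[of q]]) (auto simp: base_def)
    have "base q = (base q - {Leaf}) \<union> {Leaf}" using True by blast
    moreover have "gen_series arity ((base q - {Leaf}) \<union> {Leaf})
        = gen_series arity (base q - {Leaf}) + gen_series arity {Leaf :: 'g ptree}"
      by (rule gen_series_Un) (use True graded_finite_subset[OF gf] in auto)
    ultimately have "gen_series arity (base q)
        = gen_series arity (base q - {Leaf}) + fps_X ^ arity (Leaf :: 'g ptree)"
      by (metis gen_series_singleton)
    then show ?thesis using nl quasipoly_fps_add quasipoly_fps_X_power by metis
  next
    case False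
    then show ?thesis using nl by simp
  qed
qed

text \<open>By \<open>production_unique\<close>, the trees of state \<open>q\<close> outside
  \<open>base q\<close> share label, recursive position and siblings, so they are the fillings of
  one fixed context by \<open>trees p\<close>. The context map is returned with the equation because
  the weight of the full cycle must later be shown positive.\<close>

lemma step_equation:
  assumes "child p q" "child\<^sup>*\<^sup>* q p"
  shows "\<exists>m F. context_map p q m F \<and>
    gen_series arity (trees q) = gen_series arity (base q) + fps_X ^ m * gen_series arity (trees p)"
proof -
  obtain g ts i where t: "Node g ts \<in> trees q" "i < length ts" and p: "st (ts ! i) = p"
    using assms(1) unfolding child_def by (metis image_iff in_set_conv_nth)
  define F m where "F = (\<lambda>u. Node g (ts[i := u]))" and "m = arity (Node g ts) - arity (ts ! i)"
  have F: "context_map p q m F" using context_map_plug[OF t] unfolding p F_def m_def .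
  have "trees q \<subseteq> base q \<union> F ` trees p"
  proof
    fix s assume s: "s \<in> trees q"
    show "s \<in> base q \<union> F ` trees p"
    proof (cases "s \<in> base q")
      case False
      then obtain g' ts' i' where s': "s = Node g' ts'" "i' < length ts'" "child\<^sup>*\<^sup>* q (st (ts' ! i'))"
        using s unfolding base_def by (auto simp: in_set_conv_nth)
      then have *: "g' = g \<and> i' = i \<and> st (ts' ! i) = st (ts ! i) \<and> ts' = ts[i := ts' ! i]"
        using production_unique[OF t] s assms(2) p by metis
      have "ts' ! i \<in> trees p" using children[of g' ts'] s s' * p by (auto simp: trees_def)
      then show ?thesis using * s'(1) unfolding F_def by blast
    qed simp
  qed
  moreover have "F ` trees p \<subseteq> trees q" using F by (auto simp: context_map_def)
  moreover have "base q \<subseteq> trees q" by (auto simp: base_def)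
  ultimately have Tq: "trees q = base q \<union> F ` trees p" by blast
  have disj: "base q \<inter> F ` trees p = {}"
  proof -
    have "p \<in> st ` set (ts[i := u])" if "u \<in> trees p" for u
      using that t(2) set_update_memI[of i ts u] by (auto simp: trees_def)
    then show ?thesis using assms(2) by (fastforce simp: base_def F_def)
  qed
  have "gen_series arity (trees q) = gen_series arity (base q) + gen_series arity (F ` trees p)"
    unfolding Tq by (rule gen_series_Un[OF _ _ disj]) (rule graded_finite_subset[OF graded_trees[of q]], use Tq in blast)+
  also have "gen_series arity (F ` trees p) = fps_X ^ m * gen_series arity (trees p)"
    by (rule gen_series_image) (use F in \<open>auto simp: context_map_def\<close>)
  finally show ?thesis using F by blast
qed

text \<open>The step equations are substituted into each other along a path inside one component;
  the case \<open>p = q\<close> goes once around the cycle. The assumption on \<open>base\<close>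
  covers the whole component because the path may pass through any of its states.\<close>

lemma path_equation:
  assumes "child\<^sup>+\<^sup>+ p q" "child\<^sup>*\<^sup>* q p"
    and "\<And>s. child\<^sup>*\<^sup>* s q \<Longrightarrow> child\<^sup>*\<^sup>* q s \<Longrightarrow> quasipoly_fps (gen_series arity (base s))"
  shows "\<exists>m F R. context_map p q m F \<and> quasipoly_fps R \<and>
    gen_series arity (trees q) = R + fps_X ^ m * gen_series arity (trees p)"
  using assms
proof (induction rule: tranclp_induct)
  case (base q)
  then show ?case using step_equation[of p q] by (metis rtranclp.rtrancl_refl)
next
  case (step q s)
  have qs: "child\<^sup>*\<^sup>* q s" "child\<^sup>*\<^sup>* s q"
    using step by auto
  then obtain m F R where F: "context_map p q m F" "quasipoly_fps R"
      "gen_series arity (trees q) = R + fps_X ^ m * gen_series arity (trees p)"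
    using step by (metis rtranclp_trans)
  obtain n H where H: "context_map q s n H"
      "gen_series arity (trees s) = gen_series arity (local.base s) + fps_X ^ n * gen_series arity (trees q)"
    using step_equation[OF step.hyps(2) qs(2)] by blast
  have "context_map p s (m + n) (H \<circ> F)" by (rule context_map_comp[OF F(1) H(1)])
  moreover have "quasipoly_fps (gen_series arity (local.base s) + fps_X ^ n * R)"
    using step.prems(2)[of s] F(2)
    by (intro quasipoly_fps_add quasipoly_fps_mult quasipoly_fps_X_power) auto
  moreover have "gen_series arity (trees s) = (gen_series arity (local.base s) + fps_X ^ n * R)
      + fps_X ^ (m + n) * gen_series arity (trees p)"
    unfolding H(2) F(3) by (simp add: algebra_simps power_add)
  ultimately show ?case by blast
qed

text \<open>The measure counts the states from which \<open>q\<close> can be reached. It is constant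
  on a component and drops on leaving it downwards, so the states of one component cannot be reduced
  to each other by induction; the equation around the cycle replaces this.\<close>

lemma quasipoly_trees: "quasipoly_fps (gen_series arity (trees q))"
proof (induction "card {p. child\<^sup>+\<^sup>+ p q \<or> p = q}" arbitrary: q rule: less_induct)
  case less
  have fin: "finite {p. child\<^sup>+\<^sup>+ p s \<or> p = s}" for s
  proof -
    \<comment> \<open>\<open>s\<close> is inserted separately since it may be a value that no tree
      carries.\<close>
    have "{p. child\<^sup>+\<^sup>+ p s \<or> p = s} \<subseteq> insert s (st ` N)"
      using child_nonempty by (auto dest!: tranclpD simp: trees_def)
    then show ?thesis using finite_states finite_subset by blast
  qed
  have eq: "{p. child\<^sup>+\<^sup>+ p s \<or> p = s} = {p. child\<^sup>*\<^sup>* p s}" for s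
    by (auto dest: rtranclpD tranclp_into_rtranclp)
  have base: "quasipoly_fps (gen_series arity (base s))" if s: "child\<^sup>*\<^sup>* s q" "child\<^sup>*\<^sup>* q s" for s
  proof (rule base_quasipoly)
    fix p assume p: "child p s" "\<not> child\<^sup>*\<^sup>* s p"
    have "{r. child\<^sup>*\<^sup>* r p} \<subset> {r. child\<^sup>*\<^sup>* r q}"
    proof
      show "{r. child\<^sup>*\<^sup>* r p} \<subseteq> {r. child\<^sup>*\<^sup>* r q}" using s p by (auto intro: rtranclp_trans)
      show "{r. child\<^sup>*\<^sup>* r p} \<noteq> {r. child\<^sup>*\<^sup>* r q}" using s p by (metis mem_Collect_eq)
    qed
    then show "quasipoly_fps (gen_series arity (trees p))"
      using fin[of q] by (intro less) (auto simp: eq intro: psubset_card_mono)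
  qed
  show ?case
  proof (cases "child\<^sup>+\<^sup>+ q q")
    case True
    then obtain m F R where R: "context_map q q m F" "quasipoly_fps R"
        "gen_series arity (trees q) = R + fps_X ^ m * gen_series arity (trees q)"
      using path_equation[of q q] base by blast
    have "trees q \<noteq> {}" using True child_nonempty by (auto dest: tranclpD)
    then show ?thesis using quasipoly_fps_fixpoint[OF R(3,2)] context_map_cycle_pos[OF R(1)] by blast
  next
    case False
    have "\<not> child\<^sup>*\<^sup>* q p" if "child p q" for p
      using that False by (metis rtranclp_into_tranclp1)
    then have "base q = trees q" unfolding base_def child_def by blast
    then show ?thesis using base[of q] by simp
  qed
qed

theorem quasipoly_family: "quasipoly_fps (gen_series arity N)"
proof -
  have "N = (\<Union>q\<in>st ` N. trees q)" by (auto simp: trees_def)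
  moreover have "gen_series arity (\<Union>q\<in>st ` N. trees q) = (\<Sum>q\<in>st ` N. gen_series arity (trees q))"
    using gen_series_UN[OF finite_states, of arity trees] graded_trees by (fastforce simp: trees_def)
  ultimately show ?thesis using quasipoly_trees by (metis quasipoly_fps_sum)
qed

end


section \<open>Normal monomials\<close>

inductive grafted :: "'g ptree set \<Rightarrow> 'g ptree \<Rightarrow> 'g ptree \<Rightarrow> bool" for M where
  base: "grafted M u u"
| graft: "grafted M u w \<Longrightarrow> 1 \<le> i \<Longrightarrow> i \<le> arity w \<Longrightarrow> v \<in> M \<Longrightarrow> grafted M u (graft w i v)"

lemma grafted_trans: "grafted M v w \<Longrightarrow> grafted M u v \<Longrightarrow> grafted M u w"
  by (induction rule: grafted.induct) (auto intro: grafted.graft)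

lemma graft_list_append:
  "1 \<le> i \<Longrightarrow> graft_list (us @ t # ts) (sum_list (map arity us) + i) v
    = us @ graft_list (t # ts) i v"
  by (induction us) auto

lemma grafted_child:
  assumes "grafted M u w"
  shows "grafted M (Node g (us @ u # ts)) (Node g (us @ w # ts))"
  using assms
proof (induction rule: grafted.induct)
  case (graft u w i v)
  have "graft (Node g (us @ w # ts)) (sum_list (map arity us) + i) v = Node g (us @ graft w i v # ts)"
    using graft graft_list_append[of i us w ts v] by simp
  moreover have "sum_list (map arity us) + i \<le> arity (Node g (us @ w # ts))" using graft by simp
  ultimately show ?case
    using grafted.graft[OF graft.IH, of "sum_list (map arity us) + i" v] graft by simp
qed (rule grafted.base)

lemma grafted_children:
  assumes "list_all2 (grafted M) us ws"
  shows "grafted M (Node g us) (Node g ws)"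
proof -
  \<comment> \<open>The children are exchanged from left to right, and \<open>xs\<close> is the
    prefix already treated.\<close>
  have "grafted M (Node g (xs @ us)) (Node g (xs @ ws))" for xs
    using assms
  proof (induction arbitrary: xs rule: list_all2_induct)
    case (Cons u us w ws)
    have "grafted M (Node g (xs @ u # us)) (Node g (xs @ w # us))" by (rule grafted_child) fact
    moreover have "grafted M (Node g ((xs @ [w]) @ us)) (Node g ((xs @ [w]) @ ws))" by (rule Cons.IH)
    ultimately show ?case using grafted_trans by fastforce
  qed (simp add: grafted.base)
  from this[of "[]"] show ?thesis by simp
qed

lemma at_root_grafted:
  "at_root w t \<Longrightarrow> tree_monomial \<Upsilon> ar t \<Longrightarrow> grafted {v. tree_monomial \<Upsilon> ar v} w t"
proof (induction w arbitrary: t)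
  case Leaf
  then show ?case
    using grafted.graft[OF grafted.base, of 1 Leaf t "{v. tree_monomial \<Upsilon> ar v}"] by simp
next
  case (Node g ws)
  then obtain ts where t: "t = Node g ts" and l: "list_all2 at_root ws ts" by (cases t) auto
  have "list_all2 (grafted {v. tree_monomial \<Upsilon> ar v}) ws ts"
    using l Node unfolding t list_all2_conv_all_nth by auto
  then show ?case unfolding t by (rule grafted_children)
qed

text \<open>Ideals are closed under partial compositions, whereas divisibility speaks of subtrees.
  What hangs below the occurrence of \<open>w\<close> is grafted onto its leaves by
  \<open>M\<close>; what surrounds it is restored by \<open>M'\<close>, one ancestor at a
  time.\<close>

lemma divides_closed:
  assumes M: "\<And>u i v. u \<in> L \<Longrightarrow> tree_monomial \<Upsilon> ar v \<Longrightarrow> 1 \<le> i \<Longrightarrow> i \<le> arity u \<Longrightarrow> graft u i v \<in> L"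
    and M': "\<And>u i v. u \<in> L \<Longrightarrow> tree_monomial \<Upsilon> ar v \<Longrightarrow> 1 \<le> i \<Longrightarrow> i \<le> arity v \<Longrightarrow> graft v i u \<in> L"
    and w: "w \<in> L" "divides w t" "tree_monomial \<Upsilon> ar t"
  shows "t \<in> L"
  using w(2,3)
proof (induction t)
  have root: "t \<in> L" if "at_root w t" "tree_monomial \<Upsilon> ar t" for t
    using at_root_grafted[OF that] w(1)
    by (induction rule: grafted.induct) (auto intro: M)
  {
    case Leaf
    then show ?case using root[of Leaf] by simp
  next
    case (Node g ts)
    show ?case
    proof (cases "at_root w (Node g ts)")
      case True
      then show ?thesis using root Node by blast
    next
      case False
      then obtain t where "t \<in> set ts" "divides w t" using Node.prems by auto
      then have "t \<in> L" using Node by auto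
      obtain us vs where ts: "ts = us @ t # vs" using \<open>t \<in> set ts\<close> by (meson split_list)
      \<comment> \<open>The relevant child is cut back to a leaf, whose number is
        \<open>sum_list (map arity us) + 1\<close>, and is then grafted back.\<close>
      let ?v = "Node g (us @ Leaf # vs)"
      have "tree_monomial \<Upsilon> ar ?v" using Node.prems(2) unfolding ts by auto
      then have "graft ?v (sum_list (map arity us) + 1) t \<in> L"
        using \<open>t \<in> L\<close> by (intro M') auto
      moreover have "graft ?v (sum_list (map arity us) + 1) t = Node g ts"
        using graft_list_append[of 1 us Leaf vs t] unfolding ts by simp
      ultimately show ?thesis by simp
    qed
  }
qed

section \<open>A tree automaton recognising the normal monomials\<close>

fun subtrees :: "'g ptree \<Rightarrow> 'g ptree set" where
  "subtrees Leaf = {Leaf}"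
| "subtrees (Node g ts) = insert (Node g ts) (\<Union>t\<in>set ts. subtrees t)"

lemma finite_subtrees: "finite (subtrees t)"
  by (induction t) auto

lemma subtrees_self: "t \<in> subtrees t"
  by (cases t) auto

lemma subtrees_children: "Node g ts \<in> subtrees w \<Longrightarrow> set ts \<subseteq> subtrees w"
proof (induction w)
  case (Node h us)
  then consider "ts = us" | u where "u \<in> set us" "Node g ts \<in> subtrees u" by auto
  then show ?case
  proof cases
    case 1
    then show ?thesis using subtrees_self by auto
  next
    case 2
    then show ?thesis using Node.IH by auto
  qed
qed simp

text \<open>Matching below a vertex is decided at its children by the children of the pattern. The
  forbidden patterns alone are not closed under passing to children, hence the states record all
  their \<open>subtrees\<close>.\<close>

lemma at_root_cong:
  assumes "\<And>w. w \<in> set ws \<Longrightarrow> w \<in> W"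
    and "list_all2 (\<lambda>t u. {w \<in> W. at_root w t} = {w \<in> W. at_root w u}) ts us"
  shows "at_root (Node g ws) (Node h ts) \<longleftrightarrow> at_root (Node g ws) (Node h us)"
proof -
  have "at_root (ws ! i) (ts ! i) \<longleftrightarrow> at_root (ws ! i) (us ! i)" if "i < length ts" "i < length ws" for i
  proof -
    have "ws ! i \<in> W" using assms(1) that(2) by simp
    moreover have "{w \<in> W. at_root w (ts ! i)} = {w \<in> W. at_root w (us ! i)}"
      using assms(2) that(1) by (rule list_all2_nthD)
    ultimately show ?thesis by blast
  qed
  moreover have "length us = length ts" using assms(2) by (simp add: list_all2_lengthD)
  ultimately show ?thesis by (auto simp: list_all2_conv_all_nth)
qed

definition normal_monomials :: "'g set \<Rightarrow> ('g \<Rightarrow> nat) \<Rightarrow> 'g ptree set \<Rightarrow> 'g ptree set" where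
  "normal_monomials \<Upsilon> ar W = {t. tree_monomial \<Upsilon> ar t \<and> (\<forall>w\<in>W. \<not> divides w t)}"

text \<open>The state of a tree records which subtrees of the forbidden patterns it has at its root;
  this is exactly the information a parent vertex needs.\<close>

lemma regular_normal_monomials:
  fixes \<Upsilon> :: "'g set" and W :: "'g ptree set"
  assumes "finite \<Upsilon>" "finite W"
    and "graded_finite arity (normal_monomials \<Upsilon> ar W)"
    and "subexponential_growth (\<lambda>n. real (card {t \<in> normal_monomials \<Upsilon> ar W. arity t = n}))"
  shows "regular_tree_family \<Upsilon> ar (normal_monomials \<Upsilon> ar W)
    (\<lambda>t. {w \<in> (\<Union>w\<in>W. subtrees w). at_root w t})"
proof
  let ?S = "\<Union>w\<in>W. subtrees w" and ?N = "normal_monomials \<Upsilon> ar W"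
  let ?st = "\<lambda>t. {w \<in> ?S. at_root w t}"
  show "finite \<Upsilon>" by fact
  show "?N \<subseteq> {t. tree_monomial \<Upsilon> ar t}" by (auto simp: normal_monomials_def)
  have "finite ?S" using assms(2) finite_subtrees by blast
  then have "finite (Pow ?S)" by simp
  then show "finite (?st ` ?N)" by (rule finite_subset[rotated]) auto
  show "set ts \<subseteq> ?N" if "Node g ts \<in> ?N" for g ts
    using that by (auto simp: normal_monomials_def)
  show "Node g us \<in> ?N \<and> ?st (Node g us) = ?st (Node g ts)"
    if N: "Node g ts \<in> ?N" and l: "list_all2 (\<lambda>t u. u \<in> ?N \<and> ?st t = ?st u) ts us" for g ts us
  proof -
    have len: "length us = length ts" and us: "set us \<subseteq> ?N"
      using l by (auto simp: list_all2_conv_all_nth in_set_conv_nth)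
    have same: "list_all2 (\<lambda>t u. ?st t = ?st u) ts us" using l by (rule list_all2_mono) simp
    then have root: "at_root w (Node g ts) \<longleftrightarrow> at_root w (Node g us)" if "w \<in> ?S" for w
    proof (cases w)
      case (Node h ws)
      obtain v where "v \<in> W" "w \<in> subtrees v" using \<open>w \<in> ?S\<close> by blast
      then have "set ws \<subseteq> ?S" using subtrees_children[of h ws v] Node by blast
      then show ?thesis unfolding Node by (intro at_root_cong[OF _ same]) auto
    qed simp
    have "\<not> divides w (Node g us)" if "w \<in> W" for w
    proof -
      have "w \<in> ?S" using that subtrees_self by blast
      moreover have "\<not> at_root w (Node g ts)" using N that by (auto simp: normal_monomials_def)
      ultimately have "\<not> at_root w (Node g us)" using root by blast
      then show ?thesis using us that by (auto simp: normal_monomials_def)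
    qed
    moreover have "tree_monomial \<Upsilon> ar (Node g us)"
      using N us len by (auto simp: normal_monomials_def)
    ultimately show ?thesis using root by (auto simp: normal_monomials_def)
  qed
qed (use assms in auto)


section \<open>The basis of normal monomials\<close>

lemma finite_order_greatest:
  assumes "finite S" "S \<noteq> {}" "S \<subseteq> A" "linear_order_on A (Restr r A)"
  shows "\<exists>u\<in>S. \<forall>v\<in>S. (v, u) \<in> r"
  using assms(1-3)
proof (induction S rule: finite_ne_induct)
  case (singleton x)
  then show ?case using assms(4) by (auto simp: order_on_defs refl_on_def)
next
  case (insert x S)
  then obtain u where u: "u \<in> S" "\<forall>v\<in>S. (v, u) \<in> r" by auto
  have tr: "trans (Restr r A)" and tot: "total_on A (Restr r A)" and rf: "(x, x) \<in> r"
    using assms(4) insert.prems by (auto simp: order_on_defs refl_on_def)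
  show ?case
  proof (cases "(x, u) \<in> r")
    case True
    then show ?thesis using u by blast
  next
    case False
    moreover have "x \<in> A" "u \<in> A" "x \<noteq> u" using u(1) insert.prems insert.hyps by auto
    ultimately have "(u, x) \<in> r" using tot by (auto simp: total_on_def)
    then have "(v, x) \<in> r" if "v \<in> S" for v
      using transD[OF tr, of v u x] u that insert.prems by blast
    then show ?thesis using rf by blast
  qed
qed

lemma leading_monomial_eqI:
  assumes "linear_order_on A (Restr r A)" "Poly_Mapping.keys f \<subseteq> A"
    and "u \<in> Poly_Mapping.keys f" "\<And>v. v \<in> Poly_Mapping.keys f \<Longrightarrow> (v, u) \<in> r"
  shows "leading_monomial r f = u"
  unfolding leading_monomial_def
proof (rule the_equality)
  fix w assume w: "w \<in> Poly_Mapping.keys f \<and> (\<forall>v\<in>Poly_Mapping.keys f. (v, w) \<in> r)"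
  have "antisym (Restr r A)" using assms(1) by (simp add: order_on_defs)
  then show "w = u" by (rule antisymD) (use w assms in auto)
qed (use assms in blast)

lemma leading_monomial_greatest:
  assumes "linear_order_on A (Restr r A)" "Poly_Mapping.keys f \<subseteq> A" "f \<noteq> 0"
  shows "leading_monomial r f \<in> Poly_Mapping.keys f"
    and "v \<in> Poly_Mapping.keys f \<Longrightarrow> (v, leading_monomial r f) \<in> r"
proof -
  obtain u where "u \<in> Poly_Mapping.keys f" "\<forall>v\<in>Poly_Mapping.keys f. (v, u) \<in> r"
    using finite_order_greatest[OF _ _ assms(2,1)] assms(3) by auto
  moreover from this have "leading_monomial r f = u"
    using leading_monomial_eqI[OF assms(1,2)] by blast
  ultimately show "leading_monomial r f \<in> Poly_Mapping.keys f"
    and "v \<in> Poly_Mapping.keys f \<Longrightarrow> (v, leading_monomial r f) \<in> r" by auto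
qed

text \<open>Grafting with a fixed tree acts on monomials as such a strictly increasing
  \<open>h\<close>. No other monomial of \<open>f\<close> is sent to the image of the leading one,
  so its coefficient cannot cancel.\<close>

lemma leading_monomial_map:
  fixes f :: "'g ptree \<Rightarrow>\<^sub>0 'k::comm_ring_1"
  assumes A: "linear_order_on A (Restr r A)" and B: "linear_order_on B (Restr r B)"
    and h: "\<And>u. u \<in> A \<Longrightarrow> h u \<in> B"
      "\<And>u u'. u \<in> A \<Longrightarrow> u' \<in> A \<Longrightarrow> (u, u') \<in> r - Id \<Longrightarrow> (h u, h u') \<in> r - Id"
    and f: "Poly_Mapping.keys f \<subseteq> A" "f \<noteq> 0"
  defines "f' \<equiv> \<Sum>u\<in>Poly_Mapping.keys f. Poly_Mapping.single (h u) (Poly_Mapping.lookup f u)"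
  shows "f' \<noteq> 0 \<and> leading_monomial r f' = h (leading_monomial r f)"
proof -
  let ?u = "leading_monomial r f"
  note lm = leading_monomial_greatest[OF A f]
  have less: "(h v, h ?u) \<in> r - Id" if "v \<in> Poly_Mapping.keys f" "v \<noteq> ?u" for v
    using lm(1) lm(2)[OF that(1)] that f(1) by (intro h) auto
  have keys: "Poly_Mapping.keys f' \<subseteq> h ` Poly_Mapping.keys f"
    unfolding f'_def by (rule order.trans[OF Poly_Mapping.keys_sum]) auto
  have "Poly_Mapping.lookup f' (h ?u) = (\<Sum>v\<in>Poly_Mapping.keys f. if v = ?u then Poly_Mapping.lookup f v else 0)"
    unfolding f'_def lookup_sum by (rule sum.cong) (use less in \<open>auto simp: lookup_single when_def\<close>)
  also have "\<dots> = Poly_Mapping.lookup f ?u" using lm(1) by simp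
  also have "\<dots> \<noteq> 0" using lm(1) by (simp add: in_keys_iff)
  finally have hu: "h ?u \<in> Poly_Mapping.keys f'" by (simp add: in_keys_iff)
  moreover have "(v, h ?u) \<in> r" if v: "v \<in> Poly_Mapping.keys f'" for v
  proof -
    obtain w where w: "w \<in> Poly_Mapping.keys f" "v = h w" using v keys by blast
    show ?thesis
    proof (cases "w = ?u")
      case True
      have "h ?u \<in> B" using lm(1) f(1) h(1) by blast
      then show ?thesis using B True w by (auto simp: order_on_defs refl_on_def)
    qed (use less w in blast)
  qed
  moreover have "Poly_Mapping.keys f' \<subseteq> B" using keys f(1) h(1) by blast
  ultimately have "leading_monomial r f' = h ?u" by (intro leading_monomial_eqI[OF B]) auto
  then show ?thesis using hu by auto
qed

text \<open>No Groebner basis appears here: normality refers to all leading monomials of the kernel,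
  and the classes of normal monomials form a basis for any admissible order. The finite Groebner
  basis later describes these leading monomials by finitely many patterns.\<close>

locale presented_operad = ns_operad P
  for P :: "('k::field, 'p::ab_group_add) operad" +
  fixes \<Upsilon> :: "'g set" and ar :: "'g \<Rightarrow> nat"
    and \<phi> :: "nat \<Rightarrow> ('g ptree \<Rightarrow>\<^sub>0 'k) \<Rightarrow> 'p" and r :: "'g ptree rel"
  assumes surj_hom: "operad_surj_hom (free_operad \<Upsilon> ar) P \<phi>"
    and order: "admissible_order \<Upsilon> ar r"
begin

abbreviation relations :: "nat \<Rightarrow> ('g ptree \<Rightarrow>\<^sub>0 'k) set" where
  "relations \<equiv> operad_kernel (free_operad \<Upsilon> ar) \<phi>"

definition leading_monomials :: "'g ptree set" where
  "leading_monomials = {leading_monomial r f | f n. n \<ge> 1 \<and> f \<in> relations n \<and> f \<noteq> 0}"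

lemma comps_free: "comps (free_operad \<Upsilon> ar :: ('k, 'g ptree \<Rightarrow>\<^sub>0 'k) operad) n = {f. Poly_Mapping.keys f \<subseteq> tree_monomials \<Upsilon> ar n}"
  by (simp add: free_operad_def)

lemma relations_iff: "f \<in> relations n \<longleftrightarrow> Poly_Mapping.keys f \<subseteq> tree_monomials \<Upsilon> ar n \<and> \<phi> n f = 0"
  by (auto simp: operad_kernel_def comps_free)

lemma hom: "operad_hom (free_operad \<Upsilon> ar) P \<phi>"
  using surj_hom by (simp add: operad_surj_hom_def)

lemma linear_order: "n \<ge> 1 \<Longrightarrow> linear_order_on (tree_monomials \<Upsilon> ar n) (Restr r (tree_monomials \<Upsilon> ar n))"
  using order by (auto simp: admissible_order_def well_order_on_def)

lemma relations_graft:
  assumes "n \<ge> 1" "m \<ge> 1" "1 \<le> i" "i \<le> n"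
    and "Poly_Mapping.keys f \<subseteq> tree_monomials \<Upsilon> ar n" "Poly_Mapping.keys g \<subseteq> tree_monomials \<Upsilon> ar m"
    and "f \<in> relations n \<or> g \<in> relations m"
  shows "graft_lin i f g \<in> relations (n + m - 1)"
proof -
  have "operad_ideal (free_operad \<Upsilon> ar) relations"
    by (rule operad_kernel_ideal[OF ns_operad_free_operad _ hom]) (rule ns_operad_axioms)
  moreover have "f \<in> comps (free_operad \<Upsilon> ar) n" "g \<in> comps (free_operad \<Upsilon> ar) m"
    using assms by (simp_all add: comps_free)
  ultimately have "pcomp (free_operad \<Upsilon> ar) n m i f g \<in> relations (n + m - 1)"
    using assms unfolding operad_ideal_def by (meson atLeastAtMost_iff)
  then show ?thesis by (simp add: free_operad_def)
qed

lemma leading_monomialsE: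
  assumes "u \<in> leading_monomials"
  obtains f where "f \<in> relations (arity u)" "f \<noteq> 0" "leading_monomial r f = u"
    "arity u \<ge> 1" "tree_monomial \<Upsilon> ar u"
proof -
  obtain f n where f: "n \<ge> 1" "f \<in> relations n" "f \<noteq> 0" "leading_monomial r f = u"
    using assms unfolding leading_monomials_def by blast
  have "u \<in> Poly_Mapping.keys f"
    using leading_monomial_greatest(1)[OF linear_order[OF f(1)], of f] f by (simp add: relations_iff)
  then have "u \<in> tree_monomials \<Upsilon> ar n" using f(2) by (auto simp: relations_iff)
  then show ?thesis using that[of f] f by (simp add: tree_monomials_def)
qed

text \<open>Composing a relation with a single monomial gives a relation, and the two monotonicity
  conditions on the order identify its leading monomial.\<close>

lemma leading_monomials_graft:
  assumes "u \<in> leading_monomials" "tree_monomial \<Upsilon> ar v"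
  shows "1 \<le> i \<Longrightarrow> i \<le> arity u \<Longrightarrow> graft u i v \<in> leading_monomials"
    and "1 \<le> i \<Longrightarrow> i \<le> arity v \<Longrightarrow> graft v i u \<in> leading_monomials"
proof -
  obtain f where f: "f \<in> relations (arity u)" "f \<noteq> 0" "leading_monomial r f = u" "arity u \<ge> 1"
    using leading_monomialsE[OF assms(1)] by blast
  have v: "v \<in> tree_monomials \<Upsilon> ar (arity v)" "arity v \<ge> 1"
    using assms(2) arity_pos[OF assms(2)] by (auto simp: tree_monomials_def)
  have k: "Poly_Mapping.keys f \<subseteq> tree_monomials \<Upsilon> ar (arity u)" using f(1) by (simp add: relations_iff)
  have s: "Poly_Mapping.keys (Poly_Mapping.single v (1::'k)) \<subseteq> tree_monomials \<Upsilon> ar (arity v)" using v by simp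
  have n: "arity u + arity v - 1 \<ge> 1" "arity v + arity u - 1 \<ge> 1" using f(4) v(2) by linarith+
  {
    assume i: "1 \<le> i" "i \<le> arity u"
    let ?f = "graft_lin i f (Poly_Mapping.single v 1)"
    have eq: "?f = (\<Sum>x\<in>Poly_Mapping.keys f. Poly_Mapping.single (graft x i v) (Poly_Mapping.lookup f x))"
      by (subst graft_lin_superset[of "Poly_Mapping.keys f" _ "{v}"]) auto
    have "?f \<in> relations (arity u + arity v - 1)"
      by (rule relations_graft) (use f v i k s in auto)
    moreover have "?f \<noteq> 0 \<and> leading_monomial r ?f = graft u i v"
      unfolding eq f(3)[symmetric]
    proof (rule leading_monomial_map[OF linear_order[OF f(4)] linear_order[OF n(1)]])
      show "graft x i v \<in> tree_monomials \<Upsilon> ar (arity u + arity v - 1)"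
        if "x \<in> tree_monomials \<Upsilon> ar (arity u)" for x
        by (rule graft_tree_monomials) (use i v that in auto)
      show "(graft x i v, graft y i v) \<in> r - Id" if "x \<in> tree_monomials \<Upsilon> ar (arity u)"
        "y \<in> tree_monomials \<Upsilon> ar (arity u)" "(x, y) \<in> r - Id" for x y
        using order that i v f(4) unfolding admissible_order_def by (meson atLeastAtMost_iff)
    qed (use k f in auto)
    ultimately show "graft u i v \<in> leading_monomials"
      using n(1) unfolding leading_monomials_def by (metis (mono_tags, lifting) mem_Collect_eq)
  next
    assume i: "1 \<le> i" "i \<le> arity v"
    let ?f = "graft_lin i (Poly_Mapping.single v 1) f"
    have eq: "?f = (\<Sum>x\<in>Poly_Mapping.keys f. Poly_Mapping.single (graft v i x) (Poly_Mapping.lookup f x))"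
      by (subst graft_lin_superset[of "{v}" _ "Poly_Mapping.keys f"]) auto
    have "?f \<in> relations (arity v + arity u - 1)"
      by (rule relations_graft) (use f v i k s in auto)
    moreover have "?f \<noteq> 0 \<and> leading_monomial r ?f = graft v i u"
      unfolding eq f(3)[symmetric]
    proof (rule leading_monomial_map[OF linear_order[OF f(4)] linear_order[OF n(2)]])
      show "graft v i x \<in> tree_monomials \<Upsilon> ar (arity v + arity u - 1)"
        if "x \<in> tree_monomials \<Upsilon> ar (arity u)" for x
        by (rule graft_tree_monomials) (use i v that in auto)
      show "(graft v i x, graft v i y) \<in> r - Id" if "x \<in> tree_monomials \<Upsilon> ar (arity u)"
        "y \<in> tree_monomials \<Upsilon> ar (arity u)" "(x, y) \<in> r - Id" for x y
        using order that i v f(4) unfolding admissible_order_def by (meson atLeastAtMost_iff)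
    qed (use k f in auto)
    ultimately show "graft v i u \<in> leading_monomials"
      using n(2) unfolding leading_monomials_def by (metis (mono_tags, lifting) mem_Collect_eq)
  }
qed

section \<open>Normal monomials represent a basis of each component\<close>

definition normal_forms :: "nat \<Rightarrow> 'g ptree set" where
  "normal_forms n = {t \<in> tree_monomials \<Upsilon> ar n. t \<notin> leading_monomials}"

definition monomial_class :: "nat \<Rightarrow> 'g ptree \<Rightarrow> 'p" where
  "monomial_class n t = \<phi> n (Poly_Mapping.single t 1)"

lemma phi_sum_single:
  assumes "n \<ge> 1" "finite S" "S \<subseteq> tree_monomials \<Upsilon> ar n"
  shows "\<phi> n (\<Sum>x\<in>S. Poly_Mapping.single x (c x)) = (\<Sum>x\<in>S. scal P (c x) (monomial_class n x))"
  using assms(2,3)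
proof (induction S)
  case empty
  have "\<phi> n (scal (free_operad \<Upsilon> ar) 0 0) = scal P 0 (\<phi> n 0)"
    using hom assms(1) unfolding operad_hom_def by (simp add: comps_free)
  moreover have "scal (free_operad \<Upsilon> ar) 0 0 = (0 :: 'g ptree \<Rightarrow>\<^sub>0 'k)"
    by (intro poly_mapping_eqI) (simp add: free_operad_def lookup_scale)
  ultimately show ?case by simp
next
  case (insert x S)
  let ?f = "\<Sum>x\<in>S. Poly_Mapping.single x (c x)"
  have "Poly_Mapping.keys ?f \<subseteq> tree_monomials \<Upsilon> ar n"
    by (rule order.trans[OF Poly_Mapping.keys_sum]) (use insert.prems in auto)
  then have "\<phi> n (Poly_Mapping.single x (c x) + ?f) = \<phi> n (Poly_Mapping.single x (c x)) + \<phi> n ?f"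
    using hom assms(1) insert.prems unfolding operad_hom_def by (simp add: comps_free)
  moreover have "\<phi> n (scal (free_operad \<Upsilon> ar) (c x) (Poly_Mapping.single x 1)) = scal P (c x) (monomial_class n x)"
    using hom assms(1) insert.prems unfolding operad_hom_def monomial_class_def by (simp add: comps_free)
  then have "\<phi> n (Poly_Mapping.single x (c x)) = scal P (c x) (monomial_class n x)"
    by (simp add: free_operad_def scale_single)
  ultimately show ?case using insert by simp
qed

lemma poly_mapping_sum_single: "(\<Sum>x\<in>Poly_Mapping.keys f. Poly_Mapping.single x (Poly_Mapping.lookup f x)) = f"
  by (rule poly_mapping_eqI) (simp add: lookup_sum lookup_single when_def in_keys_iff)

lemma phi_eq_sum:
  assumes "n \<ge> 1" "Poly_Mapping.keys f \<subseteq> tree_monomials \<Upsilon> ar n"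
  shows "\<phi> n f = (\<Sum>x\<in>Poly_Mapping.keys f. scal P (Poly_Mapping.lookup f x) (monomial_class n x))"
  using phi_sum_single[OF assms(1) _ assms(2), of "Poly_Mapping.lookup f"]
  by (simp add: poly_mapping_sum_single)

text \<open>A linear relation lifts to an element of the kernel supported on normal monomials; if
  nonzero, its leading monomial would be normal and leading at once. The sum runs over trees rather
  than over their classes, so that injectivity of \<open>monomial_class\<close> follows as
  well.\<close>

lemma normal_forms_independent:
  assumes "n \<ge> 1" "finite S" "S \<subseteq> normal_forms n" "(\<Sum>x\<in>S. scal P (c x) (monomial_class n x)) = 0" "x \<in> S"
  shows "c x = 0"
proof -
  define f where "f = (\<Sum>x\<in>S. Poly_Mapping.single x (c x))"
  have lookup: "Poly_Mapping.lookup f y = (if y \<in> S then c y else 0)" for y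
    using assms(2) by (simp add: f_def lookup_sum lookup_single when_def)
  have "f \<in> relations n"
    unfolding relations_iff
  proof
    show "Poly_Mapping.keys f \<subseteq> tree_monomials \<Upsilon> ar n"
      using assms(3) by (auto simp: in_keys_iff lookup normal_forms_def split: if_splits)
    show "\<phi> n f = 0"
      unfolding f_def using assms by (subst phi_sum_single) (auto simp: normal_forms_def)
  qed
  have "f = 0"
  proof (rule ccontr)
    assume "f \<noteq> 0"
    then have "leading_monomial r f \<in> leading_monomials"
      using \<open>f \<in> relations n\<close> assms(1) unfolding leading_monomials_def by blast
    moreover have "leading_monomial r f \<in> Poly_Mapping.keys f"
      using \<open>f \<in> relations n\<close> \<open>f \<noteq> 0\<close> unfolding relations_iff
      by (intro leading_monomial_greatest(1)[OF linear_order[OF assms(1)]]) auto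
    then have "leading_monomial r f \<in> S" by (auto simp: in_keys_iff lookup split: if_splits)
    ultimately show False using assms(3) by (auto simp: normal_forms_def)
  qed
  then show ?thesis using lookup[of x] assms(5) by simp
qed

lemma monomial_class_inj: assumes "n \<ge> 1" shows "inj_on (monomial_class n) (normal_forms n)"
proof (rule inj_onI, rule ccontr)
  fix x y assume xy: "x \<in> normal_forms n" "y \<in> normal_forms n" "monomial_class n x = monomial_class n y" "x \<noteq> y"
  have "(\<Sum>z\<in>{x, y}. scal P (if z = x then 1 else - 1) (monomial_class n z)) = 0"
    using xy(3,4) by simp
  from normal_forms_independent[OF assms _ _ this, of x] show False using xy by simp
qed

lemma monomial_class_independent: assumes "n \<ge> 1" shows "independent (monomial_class n ` normal_forms n)"
  unfolding dependent_explicit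
proof clarify
  fix T u v
  assume T: "finite T" "T \<subseteq> monomial_class n ` normal_forms n" "(\<Sum>v\<in>T. scal P (u v) v) = 0" "v \<in> T" "u v \<noteq> 0"
  obtain S where S: "S \<subseteq> normal_forms n" "inj_on (monomial_class n) S" "T = monomial_class n ` S"
    using T(2) by (auto simp: subset_image_inj)
  have "finite S" using S T(1) finite_imageD by blast
  have "(\<Sum>x\<in>S. scal P (u (monomial_class n x)) (monomial_class n x)) = 0"
    using T(3) unfolding S(3) sum.reindex[OF S(2)] by simp
  then have "u (monomial_class n x) = 0" if "x \<in> S" for x
    using normal_forms_independent[OF assms \<open>finite S\<close> S(1), of "\<lambda>x. u (monomial_class n x)"] that by blast
  then show False using T(4,5) S(3) by blast
qed

text \<open>Reduction along the well-order: a relation with leading monomial \<open>t\<close>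
  expresses the class of \<open>t\<close> through classes of smaller monomials of the same
  arity.\<close>

lemma monomial_class_span:
  assumes "n \<ge> 1" "t \<in> tree_monomials \<Upsilon> ar n"
  shows "monomial_class n t \<in> span (monomial_class n ` normal_forms n)"
proof -
  have "wf (Restr r (tree_monomials \<Upsilon> ar n) - Id)"
    using order assms(1) by (auto simp: admissible_order_def well_order_on_def)
  then show ?thesis using assms(2)
  proof (induction t rule: wf_induct_rule)
    case (less t)
    show ?case
    proof (cases "t \<in> leading_monomials")
      case False
      then show ?thesis using less.prems by (intro span_base) (simp add: normal_forms_def)
    next
      case True
      have "arity t = n" using less.prems by (simp add: tree_monomials_def)
      then obtain f where f: "f \<in> relations n" "f \<noteq> 0" "leading_monomial r f = t"
        using leading_monomialsE[OF True] by metis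
      have k: "Poly_Mapping.keys f \<subseteq> tree_monomials \<Upsilon> ar n" "\<phi> n f = 0"
        using f(1) by (simp_all add: relations_iff)
      note lm = leading_monomial_greatest[OF linear_order[OF assms(1)] k(1) f(2), unfolded f(3)]
      let ?R = "\<Sum>x\<in>Poly_Mapping.keys f - {t}. scal P (Poly_Mapping.lookup f x) (monomial_class n x)"
      have "scal P (Poly_Mapping.lookup f t) (monomial_class n t) + ?R = 0"
        using phi_eq_sum[OF assms(1) k(1)] k(2) lm(1) by (simp add: sum.remove)
      then have "scal P (Poly_Mapping.lookup f t) (monomial_class n t) = - ?R" by (simp add: eq_neg_iff_add_eq_0)
      moreover have "?R \<in> span (monomial_class n ` normal_forms n)"
        by (intro span_sum span_scale less.IH) (use lm k less.prems in auto)
      ultimately have "scal P (Poly_Mapping.lookup f t) (monomial_class n t) \<in> span (monomial_class n ` normal_forms n)"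
        by (simp only: span_neg)
      from span_scale[OF this, of "inverse (Poly_Mapping.lookup f t)"] show ?thesis
        using lm(1) by (simp add: in_keys_iff)
    qed
  qed
qed

lemma comps_subset_span:
  assumes "n \<ge> 1" shows "comps P n \<subseteq> span (monomial_class n ` normal_forms n)"
proof
  fix y assume "y \<in> comps P n"
  then obtain f where f: "Poly_Mapping.keys f \<subseteq> tree_monomials \<Upsilon> ar n" "y = \<phi> n f"
    using surj_hom assms unfolding operad_surj_hom_def by (force simp: comps_free)
  show "y \<in> span (monomial_class n ` normal_forms n)"
    unfolding f(2) phi_eq_sum[OF assms f(1)]
    by (intro span_sum span_scale monomial_class_span assms) (use f(1) in auto)
qed

lemma monomial_class_comps:
  assumes "n \<ge> 1" shows "monomial_class n ` normal_forms n \<subseteq> comps P n"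
  using hom assms unfolding operad_hom_def monomial_class_def by (auto simp: comps_free normal_forms_def)

text \<open>Finiteness cannot be read off from \<open>operad_dim\<close>, since \<open>dim\<close>
  takes the value 0 on a space with an infinite basis.\<close>

lemma finite_normal_forms:
  assumes "n \<ge> 1" "finite_dim_comps P" shows "finite (normal_forms n)"
proof -
  obtain B where "finite B" "comps P n \<subseteq> span B" using assms unfolding finite_dim_comps_def by blast
  then have "finite (monomial_class n ` normal_forms n)"
    using independent_span_bound[OF _ monomial_class_independent] monomial_class_comps assms(1) by blast
  then show ?thesis using finite_imageD monomial_class_inj assms(1) by blast
qed

lemma operad_dim_eq_card: "operad_dim P n = card (normal_forms n)"
proof (cases "n = 0")
  case True
  have "normal_forms 0 = {}" using arity_pos by (force simp: normal_forms_def tree_monomials_def)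
  then show ?thesis using True by (simp add: operad_dim_def)
next
  case False
  then have n: "n \<ge> 1" by simp
  have "dim (comps P n) = card (monomial_class n ` normal_forms n)"
    by (rule dim_unique[OF monomial_class_comps comps_subset_span monomial_class_independent refl]) (rule n)+
  then show ?thesis using card_image[OF monomial_class_inj[OF n]] n by (simp add: operad_dim_def)
qed

end


theorem corollary2p4p1:
  fixes P :: "('k::field_char_0, 'p::ab_group_add) operad"
    and \<Upsilon> :: "'g set"
    and ar :: "'g \<Rightarrow> nat"
    and \<phi> :: "nat \<Rightarrow> ('g ptree \<Rightarrow>\<^sub>0 'k) \<Rightarrow> 'p"
    and r :: "'g ptree rel"
    and G :: "('g ptree \<Rightarrow>\<^sub>0 'k) set"
  assumes "ns_operad P"
    and "finite \<Upsilon>"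
    and "\<And>g. g \<in> \<Upsilon> \<Longrightarrow> 1 \<le> ar g"
    and "operad_surj_hom (free_operad \<Upsilon> ar) P \<phi>"
    and "admissible_order \<Upsilon> ar r"
    and "finite G"
    and "groebner_basis r (operad_kernel (free_operad \<Upsilon> ar) \<phi>) G"
    and "finite_dim_comps P"
    and "subexponential_growth (\<lambda>n. real (operad_dim P n))"
  shows "rational_fps (operad_gen_series P) \<and> polynomial_growth (\<lambda>n. real (operad_dim P n))"
proof -
  interpret presented_operad P \<Upsilon> ar \<phi> r
    by (intro presented_operad.intro presented_operad_axioms.intro assms)
  \<comment> \<open>Zero elements of \<open>G\<close> are removed because
    \<open>leading_monomial r 0\<close> is an unspecified tree that could forbid too much.\<close>
  define W where "W = leading_monomial r ` {g \<in> G. g \<noteq> 0}"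
  define N where "N = normal_monomials \<Upsilon> ar W"
  have "finite W" using \<open>finite G\<close> by (simp add: W_def)
  have W: "W \<subseteq> leading_monomials"
    using assms(7) unfolding W_def groebner_basis_def leading_monomials_def by blast
  \<comment> \<open>The Groebner property gives the patterns dividing a leading monomial;
    conversely, leading monomials are closed under grafting and hence under passing to
    multiples.\<close>
  have leading_iff: "t \<in> leading_monomials \<longleftrightarrow> (\<exists>w\<in>W. divides w t)"
    if t: "tree_monomial \<Upsilon> ar t" for t
  proof
    assume "t \<in> leading_monomials"
    then obtain f where "f \<in> relations (arity t)" "f \<noteq> 0" "leading_monomial r f = t" "arity t \<ge> 1"
      using leading_monomialsE by blast
    then show "\<exists>w\<in>W. divides w t"
      using assms(7) unfolding W_def groebner_basis_def by blast
  next
    assume "\<exists>w\<in>W. divides w t"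
    then obtain w where "w \<in> leading_monomials" "divides w t" using W by blast
    then show "t \<in> leading_monomials"
      using divides_closed[OF leading_monomials_graft _ _ t] by blast
  qed
  have forms: "{t \<in> N. arity t = n} = normal_forms n" for n
    using leading_iff by (auto simp: N_def normal_monomials_def normal_forms_def tree_monomials_def)
  have dim: "operad_dim P n = card {t \<in> N. arity t = n}" for n
    unfolding forms by (rule operad_dim_eq_card)
  have "normal_forms 0 = {}" using arity_pos by (force simp: normal_forms_def tree_monomials_def)
  then have "finite (normal_forms n)" for n
    using finite_normal_forms[OF _ assms(8), of n] by (cases "n = 0") auto
  then have "graded_finite arity N" by (simp add: graded_finite_def forms)
  then have "regular_tree_family \<Upsilon> ar N (\<lambda>t. {w \<in> (\<Union>w\<in>W. subtrees w). at_root w t})"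
    using regular_normal_monomials[OF assms(2) \<open>finite W\<close>, of ar] assms(9) by (simp only: N_def dim)
  then interpret regular_tree_family \<Upsilon> ar N "\<lambda>t. {w \<in> (\<Union>w\<in>W. subtrees w). at_root w t}" .
  have "gen_series arity N = operad_gen_series P"
    by (simp add: gen_series_def operad_gen_series_def dim)
  then have "quasipoly_fps (operad_gen_series P)" using quasipoly_family by simp
  then show ?thesis
    using quasipoly_fps_imp_rational quasipoly_fps_imp_polynomial_growth
    unfolding operad_gen_series_def by blast
qed

end
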